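(* Let $(\mathcal X,\rho,\mathcal C)$ be a semi-Cartan graph with $\mathcal X$ finite, let $\mathcal R=\mathcal R(\mathcal X,\rho,\mathcal C,\Delta)$ be a generalized root system of it, and let $\mathcal W$ be its Weyl groupoid, with length function $\ell$. Let $x,y\in\mathcal X$ and $w\in\mathcal W(y,x)$ with $r:=\ell(w)>0$, and let $$w=\sigma^{x}_{i_1}\sigma_{i_2}\cdots\sigma_{i_r}=\sigma^{x}_{j_1}\sigma_{j_2}\cdots\sigma_{j_r}$$ be two reduced expressions of $w$. Let $1\le p_1<\dots<p_t\le r$ be positions forming a $(y,x)$-good subsequence of the first expression, put $a(k):=i_{p_k}$, and suppose that $$u:=\sigma^{x}_{a(1)}\sigma_{a(2)}\cdots\sigma_{a(t)}$$ satisfies $u\in\mathcal W(y,x)$ and $\ell(u)=t$. Then there are positions $1\le q_1<\dots<q_t\le r$ forming a $(y,x)$-good subsequence of the second expression such that, with $b(k):=j_{q_k}$, $$u=\sigma^{x}_{b(1)}\sigma_{b(2)}\cdots\sigma_{b(t)}.$$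
   Context: Let $\theta\in\mathbb N$, $\mathbb I=\{1,\dots,\theta\}$, $\{\alpha_i\}_{i\in\mathbb I}$ the canonical basis of $\mathbb Z^{\mathbb I}$. A basic datum $(\mathcal X,\rho)$ is a non-empty set $\mathcal X$ with permutations $\rho_i$ of $\mathcal X$ ($i\in\mathbb I$) such that $\rho_i^2=\mathrm{id}$. A semi-Cartan graph $(\mathcal X,\rho,\mathcal C)$ is a basic datum with a family $\mathcal C=(C^x)_{x\in\mathcal X}$, $C^x=(c^x_{ij})_{i,j\in\mathbb I}$, of generalized Cartan matrices (integer matrices with $c^x_{ii}=2$, and for $i\ne j$: $c^x_{ij}\le 0$, and $c^x_{ij}=0\iff c^x_{ji}=0$) such that $c^x_{ij}=c^{\rho_i(x)}_{ij}$ for all $x,i,j$. Define $s_i^x\in GL_\theta(\mathbb Z)$ by $s_i^x(\alpha_j)=\alpha_j-c^x_{ij}\alpha_i$. A generalized root system $\mathcal R(\mathcal X,\rho,\mathcal C,\Delta)$ is a family $\Delta=(\Delta^x)_{x\in\mathcal X}$ of subsets $\Delta^x\subset\mathbb Z^{\mathbb I}$ such that for all $x\in\mathcal X$, $i\neq j\in\mathbb I$: $\Delta^x=\Delta^x_+\cup\Delta^x_-$ with $\Delta^x_\pm=\pm(\Delta^x\cap\mathbb N_0^{\mathbb I})$; $\Delta^x\cap\mathbb Z\alpha_i=\{\pm\alpha_i\}$; $s_i^x(\Delta^x)=\Delta^{\rho_i(x)}$; and, with $m_{ij}^x:=|\Delta^x\cap(\mathbb N_0\alpha_i+\mathbb N_0\alpha_j)|$,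 $(\rho_i\rho_j)^{m^x_{ij}}(x)=x$ whenever $m_{ij}^x<\infty$. Put $m_{ii}^x=1$. The Weyl groupoid $\mathcal W$ is the groupoid with object set $\mathcal X$ generated by arrows $\sigma_i^x$ ($x\in\mathcal X$, $i\in\mathbb I$) with source $\rho_i(x)$ and target $x$, subject to $(\sigma_i^x\sigma_j)^{m^x_{ij}}=\mathrm{id}_x$ for all $x$ and all $i,j\in\mathbb I$ with $m^x_{ij}<\infty$ (for $i=j$ this reads $\sigma_i^x\sigma_i^{\rho_i(x)}=\mathrm{id}_x$). A product $\sigma\tau$ is defined when the source of $\sigma$ is the target of $\tau$. Omitted superscripts are the unique ones making a product composable: $\sigma_{i_1}^x\sigma_{i_2}\cdots\sigma_{i_t}$ means $\sigma_{i_1}^{x}\sigma_{i_2}^{\rho_{i_1}(x)}\cdots\sigma_{i_t}^{\rho_{i_{t-1}}\cdots\rho_{i_1}(x)}$. $\mathcal W(y,x)$ is the set of morphisms with source $y$ and target $x$. The length $\ell(w)$ of $w$ with target $x$ is the least $m$ such that $w=\sigma^x_{i_1}\cdots\sigma_{i_m}$ for some $i_1,\dots,i_m$ (identities have length $0$; the empty product is $\mathrm{id}_x$); an expression with $m=\ell(w)$ is reduced. Given a reduced expression $w=\sigma^{x}_{i_1}\cdots\sigma_{i_r}$ of $w\in\mathcal W(y,x)$, put $x_1=x$ and $x_{z+1}=\rho_{i_z}(x_z)$ for $1\le z\le r$ (so $x_{r+1}=y$). A set of positions $1\le p_1<\dots<p_t\le r$ (equivalently the subsequence $i_{p_1},\dots,i_{p_t}$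 of $i_1,\dots,i_r$) is called $(y,x)$-good if $x_{z+1}=x_z$ for every $z\in\{1,\dots,r\}\setminus\{p_1,\dots,p_t\}$. *)

theory Defs
  imports "HOL-Analysis.Finite_Cartesian_Product" "HOL-Library.Extended_Nat"
begin

text \<open>
  The index set of rank theta is an arbitrary finite type \<open>'i\<close>, and \<open>int ^ 'i\<close> is the lattice it
  spans, with canonical basis \<open>axis i 1\<close>. The set of objects is a carrier set \<open>X\<close>.
\<close>

locale basic_datum =
  fixes X :: "'x set" and \<rho> :: "'i::finite \<Rightarrow> 'x \<Rightarrow> 'x"
  assumes nonempty: "X \<noteq> {}"
    and perm: "bij_betw (\<rho> i) X X"
    and invol: "x \<in> X \<Longrightarrow> \<rho> i (\<rho> i x) = x"

definition gen_cartan_matrix :: "int ^ 'i ^ 'i \<Rightarrow> bool" where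
  "gen_cartan_matrix A \<longleftrightarrow>
     (\<forall>i. A $ i $ i = 2) \<and>
     (\<forall>i j. i \<noteq> j \<longrightarrow> A $ i $ j \<le> 0 \<and> (A $ i $ j = 0 \<longleftrightarrow> A $ j $ i = 0))"

locale semi_cartan_graph = basic_datum X \<rho>
  for X :: "'x set" and \<rho> :: "'i::finite \<Rightarrow> 'x \<Rightarrow> 'x" +
  fixes C :: "'x \<Rightarrow> int ^ 'i ^ 'i"
  assumes cartan: "x \<in> X \<Longrightarrow> gen_cartan_matrix (C x)"
    and cartan_row: "x \<in> X \<Longrightarrow> C x $ i $ j = C (\<rho> i x) $ i $ j"

text \<open>The matrix whose \<open>j\<close>-th column is the image of the \<open>j\<close>-th basis vector.\<close>

definition simple_reflection :: "('x \<Rightarrow> int ^ 'i ^ 'i) \<Rightarrow> 'x \<Rightarrow> 'i::finite \<Rightarrow> int ^ 'i ^ 'i" where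
  "simple_reflection C x i = (\<chi> k j. (axis j 1 - (C x $ i $ j) *s axis i 1) $ k)"

definition pos_roots :: "('x \<Rightarrow> (int ^ 'i) set) \<Rightarrow> 'x \<Rightarrow> (int ^ 'i::finite) set" where
  "pos_roots \<Delta> x = \<Delta> x \<inter> {\<beta>. \<forall>k. 0 \<le> \<beta> $ k}"

definition root_count :: "('x \<Rightarrow> (int ^ 'i) set) \<Rightarrow> 'x \<Rightarrow> 'i::finite \<Rightarrow> 'i \<Rightarrow> enat" where
  "root_count \<Delta> x i j =
     (if i = j then 1
      else (let S = \<Delta> x \<inter> {int a *s axis i 1 + int b *s axis j 1 | a b. True}
            in if finite S then enat (card S) else \<infinity>))"

locale generalized_root_system = semi_cartan_graph X \<rho> C
  for X :: "'x set" and \<rho> :: "'i::finite \<Rightarrow> 'x \<Rightarrow> 'x" and C :: "'x \<Rightarrow> int ^ 'i ^ 'i" +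
  fixes \<Delta> :: "'x \<Rightarrow> (int ^ 'i) set"
  assumes pos_neg: "x \<in> X \<Longrightarrow> \<Delta> x = pos_roots \<Delta> x \<union> uminus ` pos_roots \<Delta> x"
    and multiples: "x \<in> X \<Longrightarrow> \<Delta> x \<inter> range (\<lambda>a. a *s axis i 1) = {axis i 1, - axis i 1}"
    and reflect: "x \<in> X \<Longrightarrow> (\<lambda>\<beta>. simple_reflection C x i *v \<beta>) ` \<Delta> x = \<Delta> (\<rho> i x)"
    and coxeter: "x \<in> X \<Longrightarrow> i \<noteq> j \<Longrightarrow> root_count \<Delta> x i j < \<infinity> \<Longrightarrow>
                    ((\<rho> i \<circ> \<rho> j) ^^ the_enat (root_count \<Delta> x i j)) x = x"

text \<open>
  The Weyl groupoid is presented by generators and relations: it is the quotient of the free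
  groupoid on the arrows \<open>\<sigma>\<close> by the Coxeter relations. A composable word of the free groupoid is
  determined by its target \<open>x\<close> and a list of letters, where \<open>(i, True)\<close>, read with target \<open>z\<close>, is
  \<open>\<sigma>\<close> with lower index \<open>i\<close> and upper index \<open>z\<close>, and \<open>(i, False)\<close>, read with target \<open>z\<close>, is the
  formal inverse of \<open>\<sigma>\<close> with lower index \<open>i\<close> and upper index \<open>\<rho> i z\<close>. Both have source \<open>\<rho> i z\<close>.
  Words are written as products, so the first letter of the list has target \<open>x\<close>.
\<close>

definition word_source :: "('i \<Rightarrow> 'x \<Rightarrow> 'x) \<Rightarrow> 'x \<Rightarrow> ('i \<times> bool) list \<Rightarrow> 'x" where
  "word_source \<rho> x ws = fold (\<lambda>l. \<rho> (fst l)) ws x"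

inductive word_eq ::
  "('i::finite \<Rightarrow> 'x \<Rightarrow> 'x) \<Rightarrow> ('x \<Rightarrow> (int ^ 'i) set) \<Rightarrow> 'x \<Rightarrow>
     ('i \<times> bool) list \<Rightarrow> ('i \<times> bool) list \<Rightarrow> bool"
  for \<rho> \<Delta> x where
  refl: "word_eq \<rho> \<Delta> x us us"
| sym: "word_eq \<rho> \<Delta> x us vs \<Longrightarrow> word_eq \<rho> \<Delta> x vs us"
| trans: "word_eq \<rho> \<Delta> x us vs \<Longrightarrow> word_eq \<rho> \<Delta> x vs ws \<Longrightarrow> word_eq \<rho> \<Delta> x us ws"
| cancel: "word_eq \<rho> \<Delta> x (us @ [(i, e), (i, \<not> e)] @ vs) (us @ vs)"
| coxeter: "root_count \<Delta> (word_source \<rho> x us) i j = enat m \<Longrightarrow>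
     word_eq \<rho> \<Delta> x (us @ concat (replicate m [(i, True), (j, True)]) @ vs) (us @ vs)"

datatype ('x, 'i) arrow =
  Arrow (source: 'x) (target: 'x) (words: "('i \<times> bool) list set")

definition word_arrow ::
  "('i::finite \<Rightarrow> 'x \<Rightarrow> 'x) \<Rightarrow> ('x \<Rightarrow> (int ^ 'i) set) \<Rightarrow> 'x \<Rightarrow> ('i \<times> bool) list \<Rightarrow> ('x, 'i) arrow"
  where
  "word_arrow \<rho> \<Delta> x ws = Arrow (word_source \<rho> x ws) x {vs. word_eq \<rho> \<Delta> x ws vs}"

text \<open>Arrows with source \<open>y\<close> and target \<open>x\<close>.\<close>

definition weyl_hom ::
  "('i::finite \<Rightarrow> 'x \<Rightarrow> 'x) \<Rightarrow> ('x \<Rightarrow> (int ^ 'i) set) \<Rightarrow> 'x \<Rightarrow> 'x \<Rightarrow> ('x, 'i) arrow set" where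
  "weyl_hom \<rho> \<Delta> y x = {word_arrow \<rho> \<Delta> x ws | ws. word_source \<rho> x ws = y}"

definition weyl_id ::
  "('i::finite \<Rightarrow> 'x \<Rightarrow> 'x) \<Rightarrow> ('x \<Rightarrow> (int ^ 'i) set) \<Rightarrow> 'x \<Rightarrow> ('x, 'i) arrow" where
  "weyl_id \<rho> \<Delta> x = word_arrow \<rho> \<Delta> x []"

definition weyl_gen ::
  "('i::finite \<Rightarrow> 'x \<Rightarrow> 'x) \<Rightarrow> ('x \<Rightarrow> (int ^ 'i) set) \<Rightarrow> 'x \<Rightarrow> 'i \<Rightarrow> ('x, 'i) arrow" where
  "weyl_gen \<rho> \<Delta> x i = word_arrow \<rho> \<Delta> x [(i, True)]"

text \<open>Only meaningful if the source of \<open>f\<close> is the target of \<open>g\<close>.\<close>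

definition weyl_comp ::
  "('i::finite \<Rightarrow> 'x \<Rightarrow> 'x) \<Rightarrow> ('x \<Rightarrow> (int ^ 'i) set) \<Rightarrow>
     ('x, 'i) arrow \<Rightarrow> ('x, 'i) arrow \<Rightarrow> ('x, 'i) arrow" where
  "weyl_comp \<rho> \<Delta> f g =
     Arrow (source g) (target f)
       {ws. \<exists>us\<in>words f. \<exists>vs\<in>words g. word_eq \<rho> \<Delta> (target f) (us @ vs) ws}"

fun weyl_prod ::
  "('i::finite \<Rightarrow> 'x \<Rightarrow> 'x) \<Rightarrow> ('x \<Rightarrow> (int ^ 'i) set) \<Rightarrow> 'x \<Rightarrow> 'i list \<Rightarrow> ('x, 'i) arrow" where
  "weyl_prod \<rho> \<Delta> x [] = weyl_id \<rho> \<Delta> x"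
| "weyl_prod \<rho> \<Delta> x (i # is) =
     weyl_comp \<rho> \<Delta> (weyl_gen \<rho> \<Delta> x i) (weyl_prod \<rho> \<Delta> (\<rho> i x) is)"

definition weyl_length ::
  "('i::finite \<Rightarrow> 'x \<Rightarrow> 'x) \<Rightarrow> ('x \<Rightarrow> (int ^ 'i) set) \<Rightarrow> ('x, 'i) arrow \<Rightarrow> nat" where
  "weyl_length \<rho> \<Delta> w =
     (LEAST m. \<exists>is. length is = m \<and> w = weyl_prod \<rho> \<Delta> (target w) is)"

definition reduced_expression ::
  "('i::finite \<Rightarrow> 'x \<Rightarrow> 'x) \<Rightarrow> ('x \<Rightarrow> (int ^ 'i) set) \<Rightarrow> ('x, 'i) arrow \<Rightarrow> 'i list \<Rightarrow> bool" where
  "reduced_expression \<rho> \<Delta> w is \<longleftrightarrow>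
     w = weyl_prod \<rho> \<Delta> (target w) is \<and> length is = weyl_length \<rho> \<Delta> w"

text \<open>
  Positions in a word are counted from 0, so \<open>path_object \<rho> x is z\<close> is the object usually written
  with index \<open>z + 1\<close>; position \<open>z\<close> leads from \<open>path_object \<rho> x is z\<close> to
  \<open>path_object \<rho> x is (Suc z)\<close>. A choice of increasing positions is the set \<open>P\<close> of these positions,
  and \<open>nths is P\<close> is the subsequence it selects.
\<close>

definition path_object :: "('i \<Rightarrow> 'x \<Rightarrow> 'x) \<Rightarrow> 'x \<Rightarrow> 'i list \<Rightarrow> nat \<Rightarrow> 'x" where
  "path_object \<rho> x is z = fold \<rho> (take z is) x"

definition good_positions ::
  "('i \<Rightarrow> 'x \<Rightarrow> 'x) \<Rightarrow> 'x \<Rightarrow> 'x \<Rightarrow> 'i list \<Rightarrow> nat set \<Rightarrow> bool" where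
  "good_positions \<rho> y x is P \<longleftrightarrow>
     path_object \<rho> x is (length is) = y \<and>
     P \<subseteq> {..<length is} \<and>
     (\<forall>z \<in> {..<length is} - P. path_object \<rho> x is (Suc z) = path_object \<rho> x is z)"

text \<open>The composition does not depend on representatives: it is concatenation of words.\<close>

lemma word_eq_append_right:
  "word_eq \<rho> \<Delta> x us us' \<Longrightarrow> word_eq \<rho> \<Delta> x (us @ vs) (us' @ vs)"
proof (induction rule: word_eq.induct)
  case (cancel us i e vs')
  then show ?case using word_eq.cancel[of \<rho> \<Delta> x us i e "vs' @ vs"] by simp
next
  case (coxeter us i j m vs')
  then show ?case using word_eq.coxeter[of \<Delta> \<rho> x us i j m "vs' @ vs"] by simp
qed (blast intro: word_eq.intros)+

lemma word_eq_append_left: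
  "word_eq \<rho> \<Delta> (word_source \<rho> x us) vs vs' \<Longrightarrow> word_eq \<rho> \<Delta> x (us @ vs) (us @ vs')"
proof (induction rule: word_eq.induct)
  case (cancel us' i e vs)
  then show ?case using word_eq.cancel[of \<rho> \<Delta> x "us @ us'" i e vs] by simp
next
  case (coxeter us' i j m vs)
  then show ?case using word_eq.coxeter[of \<Delta> \<rho> x "us @ us'" i j m vs]
    by (simp add: word_source_def)
qed (blast intro: word_eq.intros)+

lemma weyl_comp_word_arrow:
  "weyl_comp \<rho> \<Delta> (word_arrow \<rho> \<Delta> x us) (word_arrow \<rho> \<Delta> (word_source \<rho> x us) vs) =
     word_arrow \<rho> \<Delta> x (us @ vs)"
proof -
  have "word_eq \<rho> \<Delta> x (us @ vs) (us' @ vs')"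
    if "word_eq \<rho> \<Delta> x us us'" "word_eq \<rho> \<Delta> (word_source \<rho> x us) vs vs'" for us' vs'
    using that word_eq_append_left word_eq_append_right word_eq.trans by metis
  then show ?thesis
    unfolding weyl_comp_def word_arrow_def
    by (auto simp: word_source_def intro: word_eq.refl word_eq.trans)
qed

lemma weyl_prod_eq_word_arrow:
  "weyl_prod \<rho> \<Delta> x is = word_arrow \<rho> \<Delta> x (map (\<lambda>i. (i, True)) is)"
proof (induction "is" arbitrary: x)
  case (Cons i "is")
  then show ?case
    using weyl_comp_word_arrow[of \<rho> \<Delta> x "[(i, True)]"]
    by (simp add: weyl_gen_def word_source_def)
qed (simp add: weyl_id_def)

end

(*
  Any two reduced expressions of a morphism are connected by braid moves (Matsumoto's theorem), so
  it suffices to transport a good subsequence across one braid move i j i ... -> j i j ... of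
  length m, that is, in rank two. The selected part is reduced, hence alternating. An omitted
  position fixes the current object; if both i and j fix the objects of the orbit, every
  alternating word is a good subsequence, and otherwise only the first and the last position can be
  omitted. The Coxeter relation for objects says that both sides of the move end at the same
  object, which turns an omissible first position on one side into an omissible last position on
  the other side.

  Matsumoto's theorem rests on counting the positive roots made negative by a word: if a word of
  maximal count inverts two simple roots, it inverts the whole finite rank two root system spanned
  by them, so that an alternating word of length m can be split off at its front.
*)

theory Submission
  imports Defs
begin

section \<open>Alternating words\<close>

fun alternating :: "'a \<Rightarrow> 'a \<Rightarrow> nat \<Rightarrow> 'a list" where
  "alternating p q 0 = []"
| "alternating p q (Suc n) = p # alternating q p n"

lemma length_alternating [simp]: "length (alternating p q n) = n"
  by (induction n arbitrary: p q) auto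

lemma set_alternating: "set (alternating p q n) \<subseteq> {p, q}"
  by (induction n arbitrary: p q) auto

lemma alternating_add:
  "alternating p q (m + n) =
     alternating p q m @ (if even m then alternating p q n else alternating q p n)"
  by (induction m arbitrary: p q) auto

lemma alternating_Suc_snoc:
  "alternating p q (Suc n) = alternating p q n @ [if even n then p else q]"
  using alternating_add[of p q n 1] by simp

lemma map_alternating: "map f (alternating p q n) = alternating (f p) (f q) n"
  by (induction n arbitrary: p q) auto

lemma rev_alternating:
  "rev (alternating p q n) = (if even n then alternating q p n else alternating p q n)"
proof (induction n arbitrary: p q)
  case (Suc n)
  then show ?case
    using alternating_Suc_snoc[of p q n] alternating_Suc_snoc[of q p n] by auto
qed auto

text \<open>A Coxeter relator with exponent \<open>m\<close> is an alternating word of length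
  \<open>2 * m\<close>.\<close>

lemma concat_replicate_pair: "concat (replicate m [p, q]) = alternating p q (2 * m)"
  by (induction m) auto

lemma root_count_commute: "root_count \<Delta> x i j = root_count \<Delta> x j i"
proof -
  have "{int a *s axis i (1::int) + int b *s axis j 1 | a b. True} =
        {int a *s axis j 1 + int b *s axis i 1 | a b. True}"
    by (auto; metis add.commute)
  then show ?thesis by (simp add: root_count_def)
qed

context basic_datum
begin

abbreviation path_end :: "'x \<Rightarrow> 'i list \<Rightarrow> 'x" where
  "path_end x is \<equiv> fold \<rho> is x"

lemma rho_in: "x \<in> X \<Longrightarrow> \<rho> i x \<in> X"
  using perm bij_betwE by metis

lemma path_end_in: "x \<in> X \<Longrightarrow> path_end x is \<in> X"
  by (induction "is" arbitrary: x) (auto simp: rho_in)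

lemma path_end_inj:
  "x \<in> X \<Longrightarrow> z \<in> X \<Longrightarrow> path_end x is = path_end z is \<Longrightarrow> x = z"
proof (induction "is" arbitrary: x z)
  case (Cons i "is")
  then have "\<rho> i x = \<rho> i z" by (simp add: rho_in)
  with Cons.prems show ?case by (metis invol)
qed auto

lemma path_end_rev: "x \<in> X \<Longrightarrow> path_end (path_end x is) (rev is) = x"
  by (induction "is" arbitrary: x) (auto simp: rho_in invol)

end

section \<open>Inversions and geodesic words\<close>

definition nonneg :: "int ^ 'i::finite \<Rightarrow> bool" where
  "nonneg \<beta> \<longleftrightarrow> (\<forall>k. 0 \<le> \<beta> $ k)"

text \<open>Only the coordinate with the index of the reflection changes; the sign arguments below
  use that a positive coordinate elsewhere survives.\<close>

lemma simple_reflection_apply: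
  "(simple_reflection C x i *v \<beta>) $ k =
     \<beta> $ k - (if k = i then \<Sum>j\<in>UNIV. C x $ i $ j * \<beta> $ j else 0)"
  by (auto simp: simple_reflection_def matrix_vector_mult_def axis_def left_diff_distrib
      sum_subtractf if_distrib[where f = "\<lambda>z. z * _"] cong: if_cong)

context generalized_root_system
begin

abbreviation \<alpha> :: "'i \<Rightarrow> int ^ 'i" where "\<alpha> i \<equiv> axis i 1"

definition reflection :: "'x \<Rightarrow> 'i \<Rightarrow> int ^ 'i \<Rightarrow> int ^ 'i" where
  "reflection x i \<beta> = simple_reflection C x i *v \<beta>"

lemma reflection_nth:
  "reflection x i \<beta> $ k = \<beta> $ k - (if k = i then \<Sum>j\<in>UNIV. C x $ i $ j * \<beta> $ j else 0)"
  by (simp add: reflection_def simple_reflection_apply)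

lemma reflection_add: "reflection x i (\<beta> + \<gamma>) = reflection x i \<beta> + reflection x i \<gamma>"
  by (simp add: vec_eq_iff reflection_nth distrib_left sum.distrib)

lemma reflection_smult: "reflection x i (a *s \<beta>) = a *s reflection x i \<beta>"
  by (simp add: vec_eq_iff reflection_nth sum_distrib_left right_diff_distrib mult.left_commute)

lemma reflection_minus: "reflection x i (- \<beta>) = - reflection x i \<beta>"
  by (simp add: vec_eq_iff reflection_nth sum_negf)

lemma sum_axis_int: "(\<Sum>j\<in>UNIV. f j * (axis i (1::int) :: int ^ 'i) $ j) = f i"
  by (simp add: axis_def if_distrib cong: if_cong)

lemma cartan_diag: "x \<in> X \<Longrightarrow> C x $ i $ i = 2"
  using cartan by (auto simp: gen_cartan_matrix_def)

lemma reflection_simple: "x \<in> X \<Longrightarrow> reflection x i (\<alpha> i) = - \<alpha> i"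
  by (simp add: vec_eq_iff reflection_nth sum_axis_int cartan_diag) (simp add: axis_def)

lemma reflection_rho: "x \<in> X \<Longrightarrow> reflection (\<rho> i x) i = reflection x i"
  by (simp add: fun_eq_iff vec_eq_iff reflection_nth cartan_row[symmetric])

lemma reflection_reflection:
  assumes "x \<in> X" shows "reflection x i (reflection x i \<beta>) = \<beta>"
proof -
  define c where "c = (\<Sum>j\<in>UNIV. C x $ i $ j * \<beta> $ j)"
  have "reflection x i \<beta> = \<beta> + (- c) *s \<alpha> i"
    by (simp add: vec_eq_iff reflection_nth c_def axis_def)
  then have "reflection x i (reflection x i \<beta>) = (\<beta> + (- c) *s \<alpha> i) + (- c) *s (- \<alpha> i)"
    by (metis reflection_add reflection_smult reflection_simple assms)
  then show ?thesis by (simp add: vec_eq_iff)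
qed

lemma reflection_root: "x \<in> X \<Longrightarrow> \<beta> \<in> \<Delta> x \<Longrightarrow> reflection x i \<beta> \<in> \<Delta> (\<rho> i x)"
  using reflect by (auto simp: reflection_def)

lemma simple_root: "x \<in> X \<Longrightarrow> \<alpha> i \<in> \<Delta> x"
  using multiples[of x i] by auto

lemma nonneg_simple: "nonneg (\<alpha> i)"
  by (simp add: nonneg_def axis_def)

lemma zero_not_root: "x \<in> X \<Longrightarrow> 0 \<notin> \<Delta> x"
proof
  assume x: "x \<in> X" and 0: "0 \<in> \<Delta> x"
  obtain i :: 'i where True by simp
  have "0 \<in> range (\<lambda>a. a *s \<alpha> i)" by (rule image_eqI[of _ _ 0]) (auto simp: vec_eq_iff)
  with 0 multiples[OF x, of i] have "(0 :: int ^ 'i) = \<alpha> i \<or> 0 = - \<alpha> i" by blast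
  then have "(0 :: int ^ 'i) $ i = \<alpha> i $ i \<or> (0 :: int ^ 'i) $ i = (- \<alpha> i) $ i" by metis
  then show False by (simp add: axis_def)
qed

lemma uminus_root: "x \<in> X \<Longrightarrow> \<beta> \<in> \<Delta> x \<Longrightarrow> - \<beta> \<in> \<Delta> x"
proof -
  assume "x \<in> X" "\<beta> \<in> \<Delta> x"
  then have *: "\<gamma> \<in> \<Delta> x \<longleftrightarrow> \<gamma> \<in> pos_roots \<Delta> x \<or> - \<gamma> \<in> pos_roots \<Delta> x" for \<gamma>
    using arg_cong[OF pos_neg, of x "\<lambda>A. \<gamma> \<in> A"] by (force simp: image_iff)
  show ?thesis using *[of \<beta>] *[of "- \<beta>"] \<open>\<beta> \<in> \<Delta> x\<close> by simp blast
qed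

lemma not_nonneg_uminus_simple [simp]: "\<not> nonneg (- \<alpha> i)"
  by (auto simp: nonneg_def axis_def)

lemma nonneg_uminus_iff:
  assumes "x \<in> X" "\<beta> \<in> \<Delta> x" shows "nonneg (- \<beta>) \<longleftrightarrow> \<not> nonneg \<beta>"
proof -
  have "nonneg \<beta> \<or> nonneg (- \<beta>)"
  proof -
    have "\<beta> \<in> pos_roots \<Delta> x \<union> uminus ` pos_roots \<Delta> x" using assms pos_neg by blast
    then show ?thesis by (auto simp: pos_roots_def nonneg_def)
  qed
  moreover have "\<beta> = 0" if "nonneg \<beta>" "nonneg (- \<beta>)"
    using that by (auto simp: vec_eq_iff nonneg_def intro: order_antisym)
  ultimately show ?thesis using assms zero_not_root by blast
qed

text \<open>The only roots that are multiples of \<open>\<alpha> i\<close> are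
  \<open>\<alpha> i\<close> and its negative, so any other positive root has a positive coordinate
  at some \<open>k \<noteq> i\<close>. The reflection does not touch that coordinate, and one
  positive coordinate decides the sign of a root.\<close>

lemma nonneg_reflection:
  assumes x: "x \<in> X" and \<beta>: "\<beta> \<in> \<Delta> x" "nonneg \<beta>" "\<beta> \<noteq> \<alpha> i"
  shows "nonneg (reflection x i \<beta>)" "reflection x i \<beta> \<noteq> \<alpha> i"
proof -
  have "\<exists>k. k \<noteq> i \<and> \<beta> $ k \<noteq> 0"
  proof (rule ccontr)
    assume "\<not> ?thesis"
    then have "\<beta> = \<beta> $ i *s \<alpha> i" by (auto simp: vec_eq_iff axis_def)
    then have "\<beta> \<in> \<Delta> x \<inter> range (\<lambda>a. a *s \<alpha> i)" using \<beta> by blast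
    then have "\<beta> = - \<alpha> i" using multiples[OF x, of i] \<beta> by blast
    then show False using \<beta> nonneg_simple nonneg_uminus_iff[OF x simple_root[OF x]] by metis
  qed
  then obtain k where k: "k \<noteq> i" "\<beta> $ k > 0" using \<beta> by (force simp: nonneg_def order.order_iff_strict)
  then have "reflection x i \<beta> $ k > 0" by (simp add: reflection_nth)
  then have "\<not> nonneg (- reflection x i \<beta>)" by (auto simp: nonneg_def not_le intro!: exI[of _ k])
  then show "nonneg (reflection x i \<beta>)"
    using nonneg_uminus_iff[OF rho_in[OF x] reflection_root[OF x \<beta>(1)]] by blast
  show "reflection x i \<beta> \<noteq> \<alpha> i" using \<open>reflection x i \<beta> $ k > 0\<close> k by (auto simp: axis_def)
qed

text \<open>
  Words act from their target to their source, so this is the inverse of the usual linear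
  representation of the groupoid.
\<close>

primrec act :: "'x \<Rightarrow> 'i list \<Rightarrow> int ^ 'i \<Rightarrow> int ^ 'i" where
  "act x [] \<beta> = \<beta>"
| "act x (i # is) \<beta> = act (\<rho> i x) is (reflection x i \<beta>)"

lemma act_append: "act x (us @ vs) \<beta> = act (path_end x us) vs (act x us \<beta>)"
  by (induction us arbitrary: x \<beta>) auto

lemma act_add: "act x us (\<beta> + \<gamma>) = act x us \<beta> + act x us \<gamma>"
  by (induction us arbitrary: x \<beta> \<gamma>) (auto simp: reflection_add)

lemma act_smult: "act x us (a *s \<beta>) = a *s act x us \<beta>"
  by (induction us arbitrary: x \<beta>) (auto simp: reflection_smult)

lemma act_minus: "act x us (- \<beta>) = - act x us \<beta>"
  by (induction us arbitrary: x \<beta>) (auto simp: reflection_minus)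

lemma act_root: "x \<in> X \<Longrightarrow> \<beta> \<in> \<Delta> x \<Longrightarrow> act x us \<beta> \<in> \<Delta> (path_end x us)"
  by (induction us arbitrary: x \<beta>) (auto simp: reflection_root rho_in)

lemma act_double: "x \<in> X \<Longrightarrow> act x (i # i # us) = act x us"
  by (simp add: fun_eq_iff reflection_rho reflection_reflection invol)

lemma act_rev: "x \<in> X \<Longrightarrow> act (path_end x us) (rev us) (act x us \<beta>) = \<beta>"
proof (induction us arbitrary: x \<beta>)
  case (Cons i us)
  then show ?case
    by (simp add: act_append path_end_rev rho_in reflection_rho reflection_reflection)
qed simp

text \<open>As \<open>act\<close> runs from target to source, these are roots at the target
  \<open>x\<close>; in the usual convention they are the inversions of the inverse arrow.\<close>

definition inversions :: "'x \<Rightarrow> 'i list \<Rightarrow> (int ^ 'i) set" where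
  "inversions x us = {\<beta> \<in> \<Delta> x. nonneg \<beta> \<and> \<not> nonneg (act x us \<beta>)}"

lemma inversions_Nil [simp]: "inversions x [] = {}"
  by (auto simp: inversions_def)

lemma simple_in_inversions_Cons:
  assumes "x \<in> X"
  shows "\<alpha> i \<in> inversions x (i # us) \<longleftrightarrow> \<alpha> i \<notin> inversions (\<rho> i x) us"
proof -
  have "nonneg (- act (\<rho> i x) us (\<alpha> i)) \<longleftrightarrow> \<not> nonneg (act (\<rho> i x) us (\<alpha> i))"
    using nonneg_uminus_iff[OF path_end_in act_root[OF _ simple_root]] rho_in[OF assms] by blast
  then show ?thesis
    using assms by (auto simp: inversions_def reflection_simple act_minus simple_root nonneg_simple rho_in)
qed

lemma in_inversions_Cons:
  assumes x: "x \<in> X" and "\<beta> \<noteq> \<alpha> i"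
  shows "\<beta> \<in> inversions x (i # us) \<longleftrightarrow>
           reflection x i \<beta> \<noteq> \<alpha> i \<and> reflection x i \<beta> \<in> inversions (\<rho> i x) us"
proof
  assume "\<beta> \<in> inversions x (i # us)"
  then show "reflection x i \<beta> \<noteq> \<alpha> i \<and> reflection x i \<beta> \<in> inversions (\<rho> i x) us"
    using assms nonneg_reflection[OF x, of \<beta> i] by (auto simp: inversions_def reflection_root)
next
  assume *: "reflection x i \<beta> \<noteq> \<alpha> i \<and> reflection x i \<beta> \<in> inversions (\<rho> i x) us"
  have "reflection (\<rho> i x) i (reflection x i \<beta>) = \<beta>"
    using x by (simp add: reflection_rho reflection_reflection)
  then show "\<beta> \<in> inversions x (i # us)"
    using * x nonneg_reflection(1)[OF rho_in[OF x], of "reflection x i \<beta>" i i]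
      reflection_root[OF rho_in[OF x], of "reflection x i \<beta>" i i]
    by (auto simp: inversions_def invol)
qed

text \<open>A new first letter toggles membership of the simple root that it negates and transports
  all other inversions by the reflection. Hence their number changes by exactly one.\<close>

lemma inversions_Cons:
  assumes x: "x \<in> X"
  shows "inversions x (i # us) =
    (if \<alpha> i \<in> inversions (\<rho> i x) us then {} else {\<alpha> i}) \<union>
      reflection x i ` (inversions (\<rho> i x) us - {\<alpha> i})" (is "_ = ?A \<union> ?B")
proof -
  have B: "\<beta> \<in> ?B \<longleftrightarrow> reflection x i \<beta> \<noteq> \<alpha> i \<and> reflection x i \<beta> \<in> inversions (\<rho> i x) us" for \<beta>
  proof
    assume "reflection x i \<beta> \<noteq> \<alpha> i \<and> reflection x i \<beta> \<in> inversions (\<rho> i x) us"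
    then show "\<beta> \<in> ?B"
      by (intro image_eqI[of _ _ "reflection x i \<beta>"]) (auto simp: reflection_reflection[OF x])
  qed (auto simp: reflection_reflection[OF x])
  have "\<alpha> i \<notin> ?B"
    unfolding B by (simp add: reflection_simple[OF x] inversions_def)
  then have "\<beta> \<in> inversions x (i # us) \<longleftrightarrow> \<beta> \<in> ?A \<union> ?B" for \<beta>
    using simple_in_inversions_Cons[OF x, of i us] in_inversions_Cons[OF x, of \<beta> i us] B[of \<beta>]
    by (cases "\<beta> = \<alpha> i") auto
  then show ?thesis by blast
qed

lemma inj_reflection: "x \<in> X \<Longrightarrow> inj (reflection x i)"
  by (metis injI reflection_reflection)

lemma finite_inversions: "x \<in> X \<Longrightarrow> finite (inversions x us)"
  by (induction us arbitrary: x) (auto simp: inversions_Cons rho_in)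

lemma card_inversions_Cons:
  assumes x: "x \<in> X"
  shows "card (inversions x (i # us)) =
    (if \<alpha> i \<in> inversions (\<rho> i x) us then card (inversions (\<rho> i x) us) - 1
     else Suc (card (inversions (\<rho> i x) us)))"
proof -
  let ?I = "inversions (\<rho> i x) us"
  have fin: "finite ?I" using x by (simp add: finite_inversions rho_in)
  have card: "card (reflection x i ` (?I - {\<alpha> i})) = card (?I - {\<alpha> i})"
    using inj_reflection[OF x] by (simp add: card_image inj_on_def)
  have "\<alpha> i \<notin> reflection x i ` (?I - {\<alpha> i})"
  proof
    assume "\<alpha> i \<in> reflection x i ` (?I - {\<alpha> i})"
    then have "reflection x i (\<alpha> i) \<in> ?I" using reflection_reflection[OF x] by auto
    then show False
      by (simp add: reflection_simple[OF x] inversions_def)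
  qed
  then show ?thesis using fin card by (auto simp: inversions_Cons[OF x])
qed

lemma card_inversions_le: "x \<in> X \<Longrightarrow> card (inversions x us) \<le> length us"
proof (induction us arbitrary: x)
  case (Cons i us)
  from Cons.IH[OF rho_in[OF Cons.prems, of i]] show ?case
    by (auto simp: card_inversions_Cons[OF Cons.prems])
qed simp

text \<open>Equality in \<open>card_inversions_le\<close>. This linear criterion can be checked
  letter by letter, unlike minimal length in a groupoid given by relations;
  \<open>geodesic_if_reduced\<close> provides the link.\<close>

definition geodesic :: "'x \<Rightarrow> 'i list \<Rightarrow> bool" where
  "geodesic x us \<longleftrightarrow> card (inversions x us) = length us"

lemma geodesic_Nil [simp]: "geodesic x []"
  by (simp add: geodesic_def)

lemma geodesic_Cons:
  assumes "x \<in> X"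
  shows "geodesic x (i # us) \<longleftrightarrow> geodesic (\<rho> i x) us \<and> \<alpha> i \<notin> inversions (\<rho> i x) us"
  using card_inversions_le[OF rho_in[OF assms], of i us]
  by (auto simp: geodesic_def card_inversions_Cons[OF assms])

lemma geodesic_ConsD:
  assumes "x \<in> X" "geodesic x (i # us)"
  shows "geodesic (\<rho> i x) us" "\<alpha> i \<in> inversions x (i # us)"
  using assms by (auto simp: geodesic_Cons simple_in_inversions_Cons)

lemma geodesic_appendD: "x \<in> X \<Longrightarrow> geodesic x (us @ vs) \<Longrightarrow> geodesic (path_end x us) vs"
  by (induction us arbitrary: x) (auto simp: geodesic_Cons rho_in)

lemma not_geodesic_double: "x \<in> X \<Longrightarrow> \<not> geodesic x (us @ i # i # vs)"
  using geodesic_appendD[of x us "i # i # vs"] geodesic_ConsD[of "path_end x us" i "i # vs"]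
    geodesic_ConsD(2)[of "\<rho> i (path_end x us)" i vs]
    simple_in_inversions_Cons[of "path_end x us" i "i # vs"]
  by (auto simp: path_end_in rho_in)

text \<open>Lets an induction strip a common first letter. Geodesicity keeps
  \<open>\<alpha> i\<close> out of the inversions of \<open>us\<close>, so each of them corresponds
  under the reflection to an inversion of \<open>i # us\<close>.\<close>

lemma inversions_Cons_subsetD:
  assumes x: "x \<in> X" and geo: "geodesic x (i # us)"
    and sub: "inversions x (i # us) \<subseteq> inversions x (i # vs)"
  shows "inversions (\<rho> i x) us \<subseteq> inversions (\<rho> i x) vs"
proof
  fix \<gamma> assume \<gamma>: "\<gamma> \<in> inversions (\<rho> i x) us"
  have ne: "\<gamma> \<noteq> \<alpha> i" using geo \<gamma> x by (auto simp: geodesic_Cons)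
  have refl: "reflection x i (reflection x i \<gamma>) = \<gamma>" using x by (rule reflection_reflection)
  have ne': "reflection x i \<gamma> \<noteq> \<alpha> i"
    using nonneg_reflection(2)[OF rho_in[OF x], of \<gamma> i i] \<gamma> ne x
    by (auto simp: inversions_def reflection_rho)
  then have "reflection x i \<gamma> \<in> inversions x (i # us)"
    using in_inversions_Cons[OF x ne'] refl \<gamma> ne by simp
  then show "\<gamma> \<in> inversions (\<rho> i x) vs"
    using sub in_inversions_Cons[OF x ne'] refl by auto
qed

section \<open>Rank two\<close>

text \<open>For distinct \<open>p\<close> and \<open>q\<close> this is the set that
  \<open>root_count\<close> counts, written with coordinates so that it is easily followed through
  reflections.\<close>

definition plane_roots :: "'x \<Rightarrow> 'i \<Rightarrow> 'i \<Rightarrow> (int ^ 'i) set" where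
  "plane_roots x p q = {\<beta> \<in> \<Delta> x. nonneg \<beta> \<and> (\<forall>k. k \<noteq> p \<longrightarrow> k \<noteq> q \<longrightarrow> \<beta> $ k = 0)}"

lemma plane_roots_commute: "plane_roots x p q = plane_roots x q p"
  by (auto simp: plane_roots_def)

lemma plane_expansion:
  assumes "p \<noteq> q" "\<And>k. k \<noteq> p \<Longrightarrow> k \<noteq> q \<Longrightarrow> \<beta> $ k = 0"
  shows "\<beta> = (\<beta> $ p) *s \<alpha> p + (\<beta> $ q) *s \<alpha> q"
  using assms by (auto simp: vec_eq_iff axis_def)

lemma plane_roots_eq:
  assumes "p \<noteq> q"
  shows "\<Delta> x \<inter> {int a *s \<alpha> p + int b *s \<alpha> q | a b. True} = plane_roots x p q"
proof -
  have "\<beta> = int (nat (\<beta> $ p)) *s \<alpha> p + int (nat (\<beta> $ q)) *s \<alpha> q" if "\<beta> \<in> plane_roots x p q" for \<beta>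
    using plane_expansion[OF assms, of \<beta>] that by (simp add: plane_roots_def nonneg_def)
  then have "plane_roots x p q \<subseteq> {int a *s \<alpha> p + int b *s \<alpha> q | a b. True}" by blast
  then show ?thesis by (auto simp: plane_roots_def nonneg_def axis_def)
qed

lemma root_count_eq_enat_iff:
  "p \<noteq> q \<Longrightarrow> root_count \<Delta> x p q = enat m \<longleftrightarrow>
     finite (plane_roots x p q) \<and> card (plane_roots x p q) = m"
  unfolding root_count_def Let_def by (subst (1 2) plane_roots_eq) auto

lemma simple_in_plane_roots: "x \<in> X \<Longrightarrow> \<alpha> p \<in> plane_roots x p q"
  by (auto simp: plane_roots_def simple_root nonneg_simple) (simp add: axis_def)

lemma reflection_plane_roots_subset:
  assumes "x \<in> X"
  shows "reflection x p ` (plane_roots x p q - {\<alpha> p}) \<subseteq> plane_roots (\<rho> p x) p q - {\<alpha> p}"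
  using assms nonneg_reflection[OF assms]
  by (auto simp: plane_roots_def reflection_root) (simp add: reflection_nth)

text \<open>The reflection is undone by the reflection at \<open>\<rho> p x\<close>, so the
  inclusion holds in both directions. It follows that the Coxeter exponent is constant along paths
  with letters \<open>p\<close> and \<open>q\<close>.\<close>

lemma reflection_plane_roots:
  assumes x: "x \<in> X"
  shows "reflection x p ` (plane_roots x p q - {\<alpha> p}) = plane_roots (\<rho> p x) p q - {\<alpha> p}"
proof
  show "plane_roots (\<rho> p x) p q - {\<alpha> p} \<subseteq> reflection x p ` (plane_roots x p q - {\<alpha> p})"
  proof
    fix \<beta> assume "\<beta> \<in> plane_roots (\<rho> p x) p q - {\<alpha> p}"
    then have "reflection x p \<beta> \<in> plane_roots x p q - {\<alpha> p}"
      using reflection_plane_roots_subset[OF rho_in[OF x], of p p q] x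
      by (auto simp: reflection_rho invol)
    then show "\<beta> \<in> reflection x p ` (plane_roots x p q - {\<alpha> p})"
      by (metis image_eqI reflection_reflection x)
  qed
qed (rule reflection_plane_roots_subset[OF x])

lemma plane_roots_rho:
  assumes x: "x \<in> X" and fin: "finite (plane_roots x p q)"
  shows "finite (plane_roots (\<rho> p x) p q)" "card (plane_roots (\<rho> p x) p q) = card (plane_roots x p q)"
proof -
  have "finite (plane_roots (\<rho> p x) p q - {\<alpha> p})"
    using fin by (simp flip: reflection_plane_roots[OF x])
  then show fin': "finite (plane_roots (\<rho> p x) p q)" by simp
  have "card (plane_roots (\<rho> p x) p q - {\<alpha> p}) = card (plane_roots x p q - {\<alpha> p})"
    using inj_reflection[OF x]
    by (simp add: card_image inj_on_def flip: reflection_plane_roots[OF x])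
  then show "card (plane_roots (\<rho> p x) p q) = card (plane_roots x p q)"
    using fin fin' simple_in_plane_roots[OF x, of p q] simple_in_plane_roots[OF rho_in[OF x], of p p q]
    by (metis card_Suc_Diff1)
qed

lemma plane_roots_path_end:
  assumes "x \<in> X" "finite (plane_roots x p q)" "set us \<subseteq> {p, q}"
  shows "finite (plane_roots (path_end x us) p q) \<and>
    card (plane_roots (path_end x us) p q) = card (plane_roots x p q)"
  using assms
proof (induction us arbitrary: x)
  case (Cons i us)
  have "finite (plane_roots (\<rho> i x) p q) \<and> card (plane_roots (\<rho> i x) p q) = card (plane_roots x p q)"
    using Cons.prems plane_roots_rho[of x p q] plane_roots_rho[of x q p]
    by (auto simp: plane_roots_commute[of _ q p])
  with Cons show ?case by (simp add: rho_in)
qed simp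

lemma act_outside:
  "set us \<subseteq> {p, q} \<Longrightarrow> k \<noteq> p \<Longrightarrow> k \<noteq> q \<Longrightarrow> act x us \<beta> $ k = \<beta> $ k"
  by (induction us arbitrary: x \<beta>) (auto simp: reflection_nth)

lemma nonneg_of_coeff: "x \<in> X \<Longrightarrow> \<beta> \<in> \<Delta> x \<Longrightarrow> 0 < \<beta> $ k \<Longrightarrow> nonneg \<beta>"
proof -
  assume x: "x \<in> X" "\<beta> \<in> \<Delta> x" and "0 < \<beta> $ k"
  then have "\<not> nonneg (- \<beta>)" by (auto simp: nonneg_def not_le intro!: exI[of _ k])
  then show "nonneg \<beta>" using nonneg_uminus_iff[OF x] by blast
qed

text \<open>Letters \<open>p\<close> and \<open>q\<close> never change a coordinate outside the
  plane, and a positive one would keep the root positive.\<close>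

lemma inversions_subset_plane_roots:
  assumes x: "x \<in> X" and us: "set us \<subseteq> {p, q}"
  shows "inversions x us \<subseteq> plane_roots x p q"
proof
  fix \<beta> assume \<beta>: "\<beta> \<in> inversions x us"
  have "\<beta> $ k = 0" if "k \<noteq> p" "k \<noteq> q" for k
  proof (rule ccontr)
    assume "\<beta> $ k \<noteq> 0"
    moreover have "0 \<le> \<beta> $ k" using \<beta> by (simp add: inversions_def nonneg_def)
    ultimately have "0 < act x us \<beta> $ k" using act_outside[OF us that] by simp
    then show False
      using nonneg_of_coeff[OF path_end_in[OF x] act_root[OF x]] \<beta> by (auto simp: inversions_def)
  qed
  then show "\<beta> \<in> plane_roots x p q" using \<beta> by (auto simp: inversions_def plane_roots_def)
qed

text \<open>By linearity: a plane root is a nonnegative combination of two vectors that both become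
  negative.\<close>

lemma plane_roots_subset_inversions:
  assumes x: "x \<in> X" and pq: "p \<noteq> q" and p: "\<alpha> p \<in> inversions x us" and q: "\<alpha> q \<in> inversions x us"
  shows "plane_roots x p q \<subseteq> inversions x us"
proof
  fix \<beta> assume \<beta>: "\<beta> \<in> plane_roots x p q"
  have neg: "nonneg (- act x us (\<alpha> i))" if "\<alpha> i \<in> inversions x us" for i
    using that nonneg_uminus_iff[OF path_end_in[OF x] act_root[OF x simple_root[OF x]]]
    by (auto simp: inversions_def)
  have "\<beta> = (\<beta> $ p) *s \<alpha> p + (\<beta> $ q) *s \<alpha> q"
    using plane_expansion[OF pq, of \<beta>] \<beta> by (simp add: plane_roots_def)
  then have "act x us \<beta> = (\<beta> $ p) *s act x us (\<alpha> p) + (\<beta> $ q) *s act x us (\<alpha> q)"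
    by (metis act_add act_smult)
  then have "act x us \<beta> $ k \<le> 0" for k
    using neg[OF p] neg[OF q] \<beta>
    by (auto simp: nonneg_def plane_roots_def intro!: add_nonpos_nonpos mult_nonneg_nonpos)
  then have "nonneg (- act x us \<beta>)" by (simp add: nonneg_def)
  then show "\<beta> \<in> inversions x us"
    using \<beta> nonneg_uminus_iff[OF path_end_in[OF x] act_root[OF x]]
    by (auto simp: inversions_def plane_roots_def)
qed

text \<open>Prefixing \<open>p\<close> could fail only if the shorter word already inverts
  \<open>\<alpha> p\<close>. It also inverts the simple root of its own first letter
  \<open>q\<close>, hence all plane roots, which are more than its letters.\<close>

lemma geodesic_alternating:
  assumes "x \<in> X" "p \<noteq> q" "finite (plane_roots x p q)" "n \<le> card (plane_roots x p q)"
  shows "geodesic x (alternating p q n)"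
  using assms
proof (induction n arbitrary: x p q)
  case (Suc n)
  let ?y = "\<rho> p x" and ?a = "alternating q p n"
  have y: "?y \<in> X" using Suc.prems by (simp add: rho_in)
  have R: "finite (plane_roots ?y q p)" "card (plane_roots ?y q p) = card (plane_roots x p q)"
    using plane_roots_rho[of x p q] Suc.prems by (auto simp: plane_roots_commute[of _ q p])
  have geo: "geodesic ?y ?a" using Suc R y by simp
  have "\<alpha> p \<notin> inversions ?y ?a"
  proof
    assume p: "\<alpha> p \<in> inversions ?y ?a"
    then obtain n' where n': "n = Suc n'" by (cases n) auto
    then have "\<alpha> q \<in> inversions ?y ?a" using geo y by (auto intro: geodesic_ConsD)
    then have "plane_roots ?y q p \<subseteq> inversions ?y ?a"
      using plane_roots_subset_inversions[OF y Suc.prems(2)[symmetric]] p by blast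
    then have "card (plane_roots ?y q p) \<le> n"
      using geo finite_inversions[OF y] by (metis card_mono geodesic_def length_alternating)
    then show False using R Suc.prems by simp
  qed
  then show ?case using geo Suc.prems by (simp add: geodesic_Cons)
qed simp

lemma inversions_alternating:
  assumes "x \<in> X" "p \<noteq> q" "finite (plane_roots x p q)"
  shows "inversions x (alternating p q (card (plane_roots x p q))) = plane_roots x p q"
  using assms geodesic_alternating[OF assms order_refl]
    inversions_subset_plane_roots[OF assms(1) set_alternating]
  by (intro card_subset_eq) (auto simp: geodesic_def)

text \<open>Each half of the word inverts all plane roots at its own starting object: the first half
  makes them negative, the second makes them positive again.\<close>

lemma inversions_alternating_double:
  assumes x: "x \<in> X" and pq: "p \<noteq> q" and fin: "finite (plane_roots x p q)"
  defines "m \<equiv> card (plane_roots x p q)"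
  shows "inversions x (alternating p q (2 * m)) = {}"
proof -
  define a where "a = alternating p q m"
  \<comment> \<open>The parity of \<open>m\<close> decides the first letter of the second half;
    either way it has full length \<open>m\<close>.\<close>
  define b where "b = (if even m then alternating p q m else alternating q p m)"
  let ?z = "path_end x a"
  have z: "?z \<in> X" using x by (rule path_end_in)
  have ab: "alternating p q (2 * m) = a @ b"
    unfolding a_def b_def mult_2 by (rule alternating_add)
  have R: "finite (plane_roots ?z p q)" "card (plane_roots ?z p q) = m"
    using plane_roots_path_end[OF x fin, of a] by (auto simp: a_def m_def set_alternating)
  have inv_b: "inversions ?z b = plane_roots ?z p q"
    using inversions_alternating[OF z pq] inversions_alternating[OF z pq[symmetric]] R
    by (auto simp: b_def plane_roots_commute[of _ q p])
  have "\<beta> \<notin> inversions x (a @ b)" for \<beta>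
  proof
    assume \<beta>: "\<beta> \<in> inversions x (a @ b)"
    have "set (a @ b) \<subseteq> {p, q}" using set_alternating[of p q m] set_alternating[of q p m]
      by (auto simp: a_def b_def)
    then have \<beta>R: "\<beta> \<in> plane_roots x p q" using inversions_subset_plane_roots[OF x] \<beta> by blast
    then have neg: "\<not> nonneg (act x a \<beta>)"
      using inversions_alternating[OF x pq fin] by (auto simp: a_def m_def inversions_def)
    have root: "act x a \<beta> \<in> \<Delta> ?z" using \<beta>R x by (auto simp: plane_roots_def intro: act_root)
    have "- act x a \<beta> \<in> plane_roots ?z p q"
      using neg nonneg_uminus_iff[OF z root] uminus_root[OF z root] \<beta>R
        act_outside[OF set_alternating, of _ p q x m \<beta>]
      by (auto simp: plane_roots_def a_def)
    then have "\<not> nonneg (- act ?z b (act x a \<beta>))"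
      by (simp add: inversions_def act_minus flip: inv_b)
    then have "nonneg (act x (a @ b) \<beta>)"
      using nonneg_uminus_iff[OF path_end_in[OF z] act_root[OF z root]] by (simp add: act_append)
    with \<beta> show False by (simp add: inversions_def)
  qed
  then show ?thesis by (auto simp: ab)
qed

section \<open>Coxeter relations act trivially\<close>

definition plane_area :: "'i \<Rightarrow> 'i \<Rightarrow> int ^ 'i \<Rightarrow> int ^ 'i \<Rightarrow> int" where
  "plane_area p q \<beta> \<gamma> = \<beta> $ p * \<gamma> $ q - \<beta> $ q * \<gamma> $ p"

lemma sum_plane:
  assumes "p \<noteq> q" "\<And>k. k \<noteq> p \<Longrightarrow> k \<noteq> q \<Longrightarrow> \<beta> $ k = 0"
  shows "(\<Sum>j\<in>UNIV. f j * \<beta> $ j) = f p * \<beta> $ p + f q * (\<beta> $ q :: int)"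
proof -
  have "(\<Sum>j\<in>UNIV. f j * \<beta> $ j) = (\<Sum>j\<in>{p, q}. f j * \<beta> $ j)"
    using assms by (intro sum.mono_neutral_right) auto
  then show ?thesis using assms by simp
qed

text \<open>\<open>plane_area\<close> is the 2 by 2 determinant in the coordinates \<open>p\<close>
  and \<open>q\<close>, and each of the two reflections has determinant -1 on the plane.\<close>

lemma plane_area_reflection:
  assumes x: "x \<in> X" and pq: "p \<noteq> q" and i: "i \<in> {p, q}"
    and \<beta>: "\<And>k. k \<noteq> p \<Longrightarrow> k \<noteq> q \<Longrightarrow> \<beta> $ k = 0" and \<gamma>: "\<And>k. k \<noteq> p \<Longrightarrow> k \<noteq> q \<Longrightarrow> \<gamma> $ k = 0"
  shows "plane_area p q (reflection x i \<beta>) (reflection x i \<gamma>) = - plane_area p q \<beta> \<gamma>"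
  using i pq by (auto simp: plane_area_def reflection_nth sum_plane[OF pq \<beta>] sum_plane[OF pq \<gamma>]
      cartan_diag[OF x])
    (simp_all add: algebra_simps)

lemma plane_area_act:
  assumes "x \<in> X" "p \<noteq> q" "set us \<subseteq> {p, q}"
    and "\<And>k. k \<noteq> p \<Longrightarrow> k \<noteq> q \<Longrightarrow> \<beta> $ k = 0" and "\<And>k. k \<noteq> p \<Longrightarrow> k \<noteq> q \<Longrightarrow> \<gamma> $ k = 0"
  shows "plane_area p q (act x us \<beta>) (act x us \<gamma>) = (- 1) ^ length us * plane_area p q \<beta> \<gamma>"
  using assms
proof (induction us arbitrary: x \<beta> \<gamma>)
  case (Cons i us)
  have "plane_area p q (act x (i # us) \<beta>) (act x (i # us) \<gamma>) =
      (- 1) ^ length us * plane_area p q (reflection x i \<beta>) (reflection x i \<gamma>)"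
    unfolding act.simps using Cons.prems
    by (intro Cons.IH) (auto simp: rho_in reflection_nth)
  then show ?case using Cons.prems plane_area_reflection[of x p q i \<beta> \<gamma>] by simp
qed simp

lemma act_zero: "act x us 0 = 0"
  using act_smult[of x us 0 0] by (simp add: vec_eq_iff)

lemma act_sum: "act x us (sum f A) = (\<Sum>i\<in>A. act x us (f i))"
  by (induction A rule: infinite_finite_induct) (auto simp: act_zero act_add)

lemma act_id_of_simple:
  assumes "\<And>i. act x us (\<alpha> i) = \<alpha> i" shows "act x us \<beta> = \<beta>"
proof -
  have sum: "\<beta> = (\<Sum>i\<in>UNIV. \<beta> $ i *s \<alpha> i)"
    by (simp add: vec_eq_iff sum_component axis_def if_distrib cong: if_cong)
  have "act x us (\<Sum>i\<in>UNIV. \<beta> $ i *s \<alpha> i) = (\<Sum>i\<in>UNIV. \<beta> $ i *s \<alpha> i)"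
    by (simp add: act_sum act_smult assms)
  then show ?thesis by (simp flip: sum)
qed

text \<open>
  In the plane spanned by the two simple roots, the action is a nonnegative integer matrix with
  nonnegative inverse, hence a permutation matrix, and its determinant is 1.
\<close>

lemma act_eq_id:
  assumes z: "z \<in> X" and pq: "p \<noteq> q" and t: "set t \<subseteq> {p, q}" and even: "even (length t)"
    and "end": "path_end z t = z"
    and inv: "inversions z t = {}" and inv_rev: "inversions z (rev t) = {}"
  shows "act z t \<beta> = \<beta>"
proof -
  let ?T = "act z t" and ?T' = "act z (rev t)"
  have T'T: "?T' (?T \<gamma>) = \<gamma>" for \<gamma> using act_rev[OF z, of t \<gamma>] by (simp add: "end")
  have t': "set (rev t) \<subseteq> {p, q}" using t by simp
  have nn: "nonneg (?T (\<alpha> i))" "nonneg (?T' (\<alpha> i))" for i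
    using inv inv_rev simple_root[OF z, of i] nonneg_simple[of i] by (auto simp: inversions_def)
  have out: "?T (\<alpha> i) $ k = 0" "?T' (\<alpha> i) $ k = 0" if "i \<in> {p, q}" "k \<noteq> p" "k \<noteq> q" for i k
    using act_outside[OF t] act_outside[OF t'] that by (auto simp: axis_def)
  define a b c d where abcd: "a = ?T (\<alpha> p) $ p" "b = ?T (\<alpha> p) $ q" "c = ?T (\<alpha> q) $ p" "d = ?T (\<alpha> q) $ q"
  define a' b' c' d' where abcd': "a' = ?T' (\<alpha> p) $ p" "b' = ?T' (\<alpha> p) $ q" "c' = ?T' (\<alpha> q) $ p" "d' = ?T' (\<alpha> q) $ q"
  have nonneg: "0 \<le> a" "0 \<le> b" "0 \<le> c" "0 \<le> d" "0 \<le> a'" "0 \<le> b'" "0 \<le> c'" "0 \<le> d'"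
    using nn by (auto simp: abcd abcd' nonneg_def)
  have Tp: "?T (\<alpha> p) = a *s \<alpha> p + b *s \<alpha> q" and Tq: "?T (\<alpha> q) = c *s \<alpha> p + d *s \<alpha> q"
    unfolding abcd using out by (auto intro!: plane_expansion[OF pq])
  have "a *s ?T' (\<alpha> p) + b *s ?T' (\<alpha> q) = \<alpha> p" "c *s ?T' (\<alpha> p) + d *s ?T' (\<alpha> q) = \<alpha> q"
    using T'T[of "\<alpha> p"] T'T[of "\<alpha> q"] by (auto simp: Tp Tq act_add act_smult)
  then have eqs: "a * a' + b * c' = 1" "a * b' + b * d' = 0" "c * a' + d * c' = 0" "c * b' + d * d' = 1"
    using pq by (auto simp: vec_eq_iff abcd' axis_def split: if_splits)
  have "plane_area p q (?T (\<alpha> p)) (?T (\<alpha> q)) = plane_area p q (\<alpha> p) (\<alpha> q)"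
    using plane_area_act[OF z pq t, of "\<alpha> p" "\<alpha> q"] even by (auto simp: axis_def)
  then have det: "a * d - b * c = 1"
    using pq by (simp add: plane_area_def abcd axis_def)
  have "a \<noteq> 0" "d \<noteq> 0" using det mult_nonneg_nonneg[OF nonneg(2,3)] by auto
  moreover have "a * b' = 0" "b * d' = 0" "c * a' = 0" "d * c' = 0"
    using eqs nonneg by (auto simp: add_nonneg_eq_0_iff)
  ultimately have "b' = 0" "c' = 0" by auto
  then have "a * a' = 1" "d * d' = 1" using eqs by auto
  then have "a = 1" "a' = 1" "d = 1" "d' = 1" using nonneg by (auto simp: zmult_eq_1_iff)
  then have "b = 0" "c = 0" using \<open>b * d' = 0\<close> \<open>c * a' = 0\<close> by auto
  then have plane: "?T (\<alpha> p) = \<alpha> p" "?T (\<alpha> q) = \<alpha> q"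
    using Tp Tq \<open>a = 1\<close> \<open>d = 1\<close> by (auto simp: vec_eq_iff)
  then have plane': "?T' (\<alpha> p) = \<alpha> p" "?T' (\<alpha> q) = \<alpha> q" using T'T by metis+
  have "?T (\<alpha> k) = \<alpha> k" if k: "k \<noteq> p" "k \<noteq> q" for k
  proof -
    \<comment> \<open>\<open>?T\<close> shifts \<open>\<alpha> k\<close> by a plane vector
      \<open>\<pi>\<close>, which \<open>?T'\<close> fixes, so \<open>?T'\<close> shifts it by
      \<open>- \<pi>\<close>. Both images are nonnegative while \<open>\<alpha> k\<close> vanishes
      at \<open>p\<close> and \<open>q\<close>, which forces \<open>\<pi>\<close> to be
      zero.\<close>
    define \<pi> where "\<pi> = ?T (\<alpha> k) - \<alpha> k"
    have "\<pi> $ l = 0" if "l \<noteq> p" "l \<noteq> q" for l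
      using act_outside[OF t that] by (simp add: \<pi>_def)
    then have \<pi>: "\<pi> = \<pi> $ p *s \<alpha> p + \<pi> $ q *s \<alpha> q" by (rule plane_expansion[OF pq])
    then have "?T' \<pi> = \<pi>" by (metis act_add act_smult plane')
    moreover have "?T' (\<alpha> k) + ?T' \<pi> = \<alpha> k"
      using T'T[of "\<alpha> k"] by (simp add: \<pi>_def flip: act_add)
    ultimately have "?T' (\<alpha> k) = \<alpha> k - \<pi>" by (simp add: algebra_simps)
    moreover have "?T (\<alpha> k) = \<alpha> k + \<pi>" by (simp add: \<pi>_def)
    ultimately have "\<pi> $ l = 0" if "l \<in> {p, q}" for l
      using nn[of k] that k by (auto simp: nonneg_def axis_def dest!: spec[of _ l] split: if_splits)
    then have "\<pi> = 0" using \<pi> by (simp add: vec_eq_iff)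
    then show ?thesis by (simp add: \<pi>_def)
  qed
  with plane have "?T (\<alpha> k) = \<alpha> k" for k by metis
  then show ?thesis by (rule act_id_of_simple)
qed

lemma path_end_alternating_double:
  "path_end x (alternating p q (2 * m)) = ((\<rho> q \<circ> \<rho> p) ^^ m) x"
  by (induction m arbitrary: x) (auto simp: funpow_swap1)

text \<open>The relator and its reverse invert no root, so \<open>act_eq_id\<close> applies. For
  equal letters the exponent is 1 and the relator is a doubled letter.\<close>

lemma coxeter_relation_trivial:
  assumes x: "x \<in> X" and m: "root_count \<Delta> x p q = enat m"
  shows "path_end x (alternating p q (2 * m)) = x" "act x (alternating p q (2 * m)) = (\<lambda>\<beta>. \<beta>)"
proof -
  have "path_end x (alternating p q (2 * m)) = x \<and> act x (alternating p q (2 * m)) = (\<lambda>\<beta>. \<beta>)"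
  proof (cases "p = q")
    case True
    then have "m = 1" using m by (simp add: root_count_def one_enat_def)
    then show ?thesis using True x act_double[OF x, of q "[]"] by (simp add: fun_eq_iff numeral_2_eq_2 invol)
  next
    case False
    have R: "finite (plane_roots x p q)" "m = card (plane_roots x p q)"
      using m by (auto simp: root_count_eq_enat_iff[OF False])
    \<comment> \<open>The first letter of a word acts first on objects, so the relator in
      \<open>p\<close>, \<open>q\<close> iterates \<open>\<rho> q \<circ> \<rho> p\<close> and the
      axiom is needed with the indices swapped.\<close>
    have "root_count \<Delta> x q p = enat m" using m by (simp add: root_count_commute)
    then have "end": "path_end x (alternating p q (2 * m)) = x"
      using coxeter[OF x, of q p] False by (simp add: path_end_alternating_double)
    moreover have "act x (alternating p q (2 * m)) \<beta> = \<beta>" for \<beta>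
    proof (rule act_eq_id[OF x False set_alternating _ "end"])
      show "inversions x (alternating p q (2 * m)) = {}"
        using inversions_alternating_double[OF x False] R by simp
      have "inversions x (alternating q p (2 * m)) = {}"
        using inversions_alternating_double[OF x False[symmetric]] R
        by (simp add: plane_roots_commute[of _ q p])
      then show "inversions x (rev (alternating p q (2 * m))) = {}"
        by (simp add: rev_alternating)
    qed simp
    ultimately show ?thesis by auto
  qed
  then show "path_end x (alternating p q (2 * m)) = x" "act x (alternating p q (2 * m)) = (\<lambda>\<beta>. \<beta>)"
    by auto
qed

lemma word_source_eq: "word_source \<rho> x us = path_end x (map fst us)"
  by (induction us arbitrary: x) (auto simp: word_source_def)

text \<open>Makes the end object and the linear action functions of the arrow. Formal inverses need
  no separate treatment because every letter acts as an involution, hence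
  \<open>map fst\<close>.\<close>

lemma word_eq_invariant:
  assumes "word_eq \<rho> \<Delta> x us vs" "x \<in> X"
  shows "path_end x (map fst us) = path_end x (map fst vs) \<and>
    act x (map fst us) = act x (map fst vs)"
  using assms
proof (induction rule: word_eq.induct)
  case (cancel us i e vs)
  let ?z = "path_end x (map fst us)"
  have "?z \<in> X" using cancel by (simp add: path_end_in)
  then show ?case using act_double[of ?z i "map fst vs"] by (simp add: fun_eq_iff act_append invol)
next
  case (coxeter us i j m vs)
  let ?z = "path_end x (map fst us)"
  have "map fst (concat (replicate m [(i, True), (j, True)])) = alternating i j (2 * m)"
    by (simp only: concat_replicate_pair map_alternating fst_conv)
  then show ?case
    using coxeter coxeter_relation_trivial[OF path_end_in[of x "map fst us"], of i j m]
    by (simp add: fun_eq_iff act_append word_source_eq)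
qed auto

section \<open>Braid moves\<close>

abbreviation equivalent :: "'x \<Rightarrow> 'i list \<Rightarrow> 'i list \<Rightarrow> bool" where
  "equivalent x us vs \<equiv> word_eq \<rho> \<Delta> x (map (\<lambda>i. (i, True)) us) (map (\<lambda>i. (i, True)) vs)"

lemma equivalent_invariant:
  assumes "equivalent x us vs" "x \<in> X"
  shows "path_end x us = path_end x vs" "act x us = act x vs"
  using word_eq_invariant[OF assms] by (simp_all add: comp_def)

lemma equivalent_append_left:
  "equivalent (path_end x us) vs vs' \<Longrightarrow> equivalent x (us @ vs) (us @ vs')"
  using word_eq_append_left[where us = "map (\<lambda>i. (i, True)) us" and x = x and \<rho> = \<rho>]
  by (simp add: word_source_eq comp_def)

lemma equivalent_append_right: "equivalent x us us' \<Longrightarrow> equivalent x (us @ vs) (us' @ vs)"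
  by (simp add: word_eq_append_right)

lemma equivalent_Cons: "equivalent (\<rho> i x) us vs \<Longrightarrow> equivalent x (i # us) (i # vs)"
  using equivalent_append_left[where x = x and us = "[i]"] by simp

text \<open>Both letters carry the mark \<open>True\<close>, so \<open>cancel\<close> does not
  apply; this is the Coxeter relation for equal indices.\<close>

lemma equivalent_double: "equivalent x (i # i # us) us"
  using word_eq.coxeter[of \<Delta> \<rho> x "[]" i i 1 "map (\<lambda>i. (i, True)) us"]
  by (simp add: root_count_def one_enat_def)

lemma equivalent_rev: "equivalent x (us @ rev us) []"
proof (induction us arbitrary: x)
  case (Cons i us)
  have "equivalent x ([i] @ (us @ rev us) @ [i]) ([i] @ [] @ [i])"
    by (rule equivalent_append_left, rule equivalent_append_right) (simp add: Cons[simplified])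
  then show ?case using equivalent_double[of x i "[]"] by (auto intro: word_eq.trans)
qed (simp add: word_eq.refl)

text \<open>The relator of length \<open>2 * m\<close> is one side followed by the reverse of the
  other; multiplying by that other side on the right turns the relator into a braid
  relation.\<close>

lemma equivalent_alternating:
  assumes "root_count \<Delta> x p q = enat m"
  shows "equivalent x (alternating p q m) (alternating q p m)"
proof -
  let ?a = "alternating p q m" and ?b = "alternating q p m"
  have "equivalent x (?a @ rev ?b @ ?b) (?a @ [])"
    using equivalent_rev[of "path_end x ?a" "rev ?b"]
    by (intro equivalent_append_left) simp
  moreover have "?a @ rev ?b = alternating p q (2 * m)"
    by (simp add: mult_2 alternating_add rev_alternating)
  moreover have "equivalent x (alternating p q (2 * m) @ ?b) ?b"
    using word_eq.coxeter[of \<Delta> \<rho> x "[]" p q m "map (\<lambda>i. (i, True)) ?b"] assms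
    by (simp add: word_source_eq concat_replicate_pair map_alternating)
  ultimately show ?thesis
    by (metis append_assoc append_Nil2 word_eq.sym word_eq.trans)
qed

text \<open>The exponent \<open>m\<close> belongs to the object reached after \<open>us\<close>. A
  braid move exchanges \<open>alternating p q m\<close> for \<open>alternating q p m\<close>; the
  clause as it stands shows \<open>alternating p q m\<close> in both words, while the proofs below
  use it with \<open>alternating q p m\<close> in the second.\<close>

inductive braid_step :: "'x \<Rightarrow> 'i list \<Rightarrow> 'i list \<Rightarrow> bool" for x where
  "p \<noteq> q \<Longrightarrow> root_count \<Delta> (path_end x us) p q = enat m \<Longrightarrow>
     braid_step x (us @ alternating p q m @ vs) (us @ alternating q p m @ vs)"

abbreviation braids :: "'x \<Rightarrow> 'i list \<Rightarrow> 'i list \<Rightarrow> bool" where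
  "braids x \<equiv> (braid_step x)\<^sup>*\<^sup>*"

lemma braid_step_Cons: "braid_step (\<rho> i x) us vs \<Longrightarrow> braid_step x (i # us) (i # vs)"
proof (induction rule: braid_step.induct)
  case (1 p q us m vs)
  then show ?case using braid_step.intros[of p q "i # us" x m vs] by simp
qed

lemma braids_Cons: "braids (\<rho> i x) us vs \<Longrightarrow> braids x (i # us) (i # vs)"
  by (induction rule: rtranclp_induct) (auto intro: rtranclp.rtrancl_into_rtrancl braid_step_Cons)

lemma braids_length: "braids x us vs \<Longrightarrow> length vs = length us"
  by (induction rule: rtranclp_induct) (auto elim: braid_step.cases)

lemma braids_equivalent: "braids x us vs \<Longrightarrow> equivalent x us vs"
proof (induction rule: rtranclp_induct)
  case (step vs ws)
  from step.hyps(2) have "equivalent x vs ws"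
    by (cases rule: braid_step.cases)
      (blast intro: equivalent_append_left equivalent_append_right equivalent_alternating)
  with step.IH show ?case by (rule word_eq.trans)
qed (rule word_eq.refl)

section \<open>Descents and Matsumoto's theorem\<close>

lemma inversions_cong: "act x us = act x vs \<Longrightarrow> inversions x us = inversions x vs"
  by (simp add: inversions_def)

lemma geodesic_cong: "act x us = act x vs \<Longrightarrow> length us = length vs \<Longrightarrow> geodesic x us \<longleftrightarrow> geodesic x vs"
  by (simp add: geodesic_def inversions_cong[of x us vs])

lemma braids_invariant:
  assumes "x \<in> X" "braids x us vs"
  shows "act x us = act x vs" "inversions x us = inversions x vs" "geodesic x us \<longleftrightarrow> geodesic x vs"
proof -
  show act: "act x us = act x vs"
    using assms by (intro equivalent_invariant braids_equivalent)
  then show "inversions x us = inversions x vs" by (rule inversions_cong)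
  show "geodesic x us \<longleftrightarrow> geodesic x vs" using act assms braids_length by (metis geodesic_cong)
qed

text \<open>Serves inside the induction for \<open>braids_to_descent\<close>, so the descent
  property is assumed only for words shorter than \<open>n\<close>. The letters are split off one at
  a time, with \<open>inversions_Cons_subsetD\<close> passing the inclusion on to the rest.\<close>

lemma braids_to_alternating:
  assumes descent: "\<And>y t i. y \<in> X \<Longrightarrow> length t < n \<Longrightarrow> geodesic y t \<Longrightarrow> \<alpha> i \<in> inversions y t \<Longrightarrow>
      \<exists>t'. braids y t (i # t')"
    and "y \<in> X" "length t < n" "geodesic y t" "p \<noteq> q" "finite (plane_roots y p q)"
    and "k \<le> card (plane_roots y p q)" "inversions y (alternating p q k) \<subseteq> inversions y t"
  shows "\<exists>t'. braids y t (alternating p q k @ t')"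
  using assms(2-)
proof (induction k arbitrary: y p q t)
  case (Suc k)
  have y: "y \<in> X" and y': "\<rho> p y \<in> X" using Suc.prems by (auto simp: rho_in)
  have geo: "geodesic y (p # alternating q p k)"
    using geodesic_alternating[OF y Suc.prems(4,5,6)] by simp
  then have "\<alpha> p \<in> inversions y t" using geodesic_ConsD[OF y] Suc.prems by auto
  then obtain t1 where t1: "braids y t (p # t1)" using descent Suc.prems by blast
  note inv = braids_invariant[OF y t1]
  have R: "finite (plane_roots (\<rho> p y) q p)" "card (plane_roots (\<rho> p y) q p) = card (plane_roots y p q)"
    using plane_roots_rho[OF y Suc.prems(5)] by (auto simp: plane_roots_commute[of _ q p])
  have "\<exists>t'. braids (\<rho> p y) t1 (alternating q p k @ t')"
  proof (rule Suc.IH[OF y'])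
    show "length t1 < n" using braids_length[OF t1] Suc.prems by simp
    show "geodesic (\<rho> p y) t1" using inv Suc.prems geodesic_ConsD[OF y] by blast
    show "inversions (\<rho> p y) (alternating q p k) \<subseteq> inversions (\<rho> p y) t1"
      using Suc.prems inv by (intro inversions_Cons_subsetD[OF y geo]) simp
  qed (use R Suc.prems in auto)
  then obtain t' where "braids (\<rho> p y) t1 (alternating q p k @ t')" by blast
  then show ?case using t1 braids_Cons by (fastforce intro: rtranclp_trans)
qed auto

text \<open>If \<open>w\<close> starts with \<open>j\<close> and also inverts
  \<open>\<alpha> i\<close>, it inverts the whole plane. Then a full alternating word starting with
  \<open>j\<close> can be split off, and one braid move brings \<open>i\<close> to the
  front.\<close>

lemma braids_to_descent:
  assumes "x \<in> X" "geodesic x w" "\<alpha> i \<in> inversions x w"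
  shows "\<exists>w'. braids x w (i # w')"
  using assms
proof (induction "length w" arbitrary: x w i rule: less_induct)
  case less
  note x = less.prems(1)
  obtain j v where w: "w = j # v" using less.prems by (cases w) auto
  show ?case
  proof (cases "i = j")
    case False
    have j: "\<alpha> j \<in> inversions x w" using less.prems geodesic_ConsD[OF x] by (simp add: w)
    have sub: "plane_roots x j i \<subseteq> inversions x w"
      using plane_roots_subset_inversions[OF x False[symmetric] j] less.prems by blast
    then have fin: "finite (plane_roots x j i)" using finite_inversions[OF x] finite_subset by blast
    have "card (plane_roots x j i) \<noteq> 0" using simple_in_plane_roots[OF x, of j i] fin by auto
    \<comment> \<open>The letter \<open>j\<close> already stands in front, so only \<open>k\<close>
      letters, one less than the exponent, are extracted from the shorter word
      \<open>v\<close>.\<close>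
    then obtain k where k: "card (plane_roots x j i) = Suc k" using not0_implies_Suc by blast
    have geo: "geodesic x (j # alternating i j k)"
      using geodesic_alternating[OF x False[symmetric] fin, of "Suc k"] k by simp
    have "inversions x (j # alternating i j k) \<subseteq> inversions x (j # v)"
      using inversions_alternating[OF x False[symmetric] fin] sub k by (simp add: w)
    then have inv: "inversions (\<rho> j x) (alternating i j k) \<subseteq> inversions (\<rho> j x) v"
      by (rule inversions_Cons_subsetD[OF x geo])
    have R: "finite (plane_roots (\<rho> j x) i j)" "card (plane_roots (\<rho> j x) i j) = Suc k"
      using plane_roots_rho[OF x fin] k by (auto simp: plane_roots_commute[of _ i j])
    have "\<exists>t'. braids (\<rho> j x) v (alternating i j k @ t')"
    proof (rule braids_to_alternating[OF less.hyps])
      show "geodesic (\<rho> j x) v" using less.prems geodesic_ConsD[OF x] by (simp add: w)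
    qed (use R inv False x in \<open>auto simp: rho_in w\<close>)
    then obtain t' where "braids (\<rho> j x) v (alternating i j k @ t')" by blast
    then have "braids x w (alternating j i (Suc k) @ t')" by (simp add: w braids_Cons)
    moreover have "root_count \<Delta> x j i = enat (Suc k)"
      using False fin k by (simp add: root_count_eq_enat_iff)
    then have "braid_step x (alternating j i (Suc k) @ t') (i # alternating j i k @ t')"
      using braid_step.intros[of j i "[]" x "Suc k" t'] False by simp
    ultimately show ?thesis by (meson rtranclp.rtrancl_into_rtrancl)
  qed (auto simp: w)
qed

text \<open>If the tail is geodesic but the whole word is not, the first letter is a descent of the
  tail. Braid moves bring it to the front of the tail, where the doubled letter cancels.\<close>

lemma shorten_not_geodesic:
  "x \<in> X \<Longrightarrow> \<not> geodesic x w \<Longrightarrow> \<exists>w'. equivalent x w w' \<and> length w' < length w"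
proof (induction w arbitrary: x)
  case (Cons i w)
  have y: "\<rho> i x \<in> X" using Cons.prems by (simp add: rho_in)
  show ?case
  proof (cases "geodesic (\<rho> i x) w")
    case True
    then obtain w' where w': "braids (\<rho> i x) w (i # w')"
      using Cons.prems braids_to_descent[OF y] by (auto simp: geodesic_Cons)
    then have "equivalent x (i # w) (i # i # w')"
      by (intro equivalent_Cons braids_equivalent)
    then have "equivalent x (i # w) w'" using equivalent_double by (rule word_eq.trans)
    then show ?thesis using braids_length[OF w'] by force
  next
    case False
    then obtain w' where "equivalent (\<rho> i x) w w'" "length w' < length w" using Cons.IH y by blast
    then show ?thesis by (intro exI[of _ "i # w'"]) (simp add: equivalent_Cons[simplified])
  qed
qed simp

text \<open>Words with equal action have equal inversions, so the first letter of \<open>w\<close>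
  is a descent of \<open>v\<close>. It is moved to the front of \<open>v\<close> and stripped from
  both words.\<close>

theorem geodesics_connected_by_braids:
  "x \<in> X \<Longrightarrow> geodesic x v \<Longrightarrow> geodesic x w \<Longrightarrow> act x v = act x w \<Longrightarrow> braids x v w"
proof (induction w arbitrary: x v)
  case Nil
  then have "inversions x v = {}" by (simp add: inversions_def)
  then have "length v = 0" using Nil by (simp add: geodesic_def)
  then show ?case by simp
next
  case (Cons j w)
  note x = Cons.prems(1)
  have "\<alpha> j \<in> inversions x v"
    using geodesic_ConsD(2)[OF x Cons.prems(3)] inversions_cong[OF Cons.prems(4)] by simp
  then obtain v' where v': "braids x v (j # v')" using braids_to_descent Cons.prems by blast
  note inv = braids_invariant[OF x v']
  have "act (\<rho> j x) v' \<beta> = act (\<rho> j x) w \<beta>" for \<beta>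
  proof -
    have "act x (j # v') = act x (j # w)" using inv(1) Cons.prems(4) by metis
    from fun_cong[OF this, of "reflection x j \<beta>"] show ?thesis
      by (simp add: reflection_reflection[OF x])
  qed
  then have "braids (\<rho> j x) v' w"
    using Cons inv geodesic_ConsD[OF x] by (intro Cons.IH) (auto simp: rho_in)
  then show ?case using v' braids_Cons by (meson rtranclp_trans)
qed

lemma geodesic_distinct_adj: "x \<in> X \<Longrightarrow> geodesic x us \<Longrightarrow> distinct_adj us"
proof (induction us arbitrary: x)
  case (Cons i us)
  then have "distinct_adj us" using Cons.IH[OF rho_in geodesic_ConsD(1)] by blast
  then show ?case
    using not_geodesic_double[of x "[]" i "tl us"] Cons.prems by (cases us) auto
qed simp

section \<open>Good subsequences\<close>

text \<open>Recursive form of goodness that follows the current object and records the selected word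
  instead of the positions, so that it splits and joins along concatenations. The final object is
  not prescribed.\<close>

inductive good_sub :: "'x \<Rightarrow> 'i list \<Rightarrow> 'i list \<Rightarrow> bool" where
  Nil: "good_sub x [] []"
| Keep: "good_sub (\<rho> i x) is us \<Longrightarrow> good_sub x (i # is) (i # us)"
| Skip: "\<rho> i x = x \<Longrightarrow> good_sub x is us \<Longrightarrow> good_sub x (i # is) us"

inductive_cases good_sub_NilE: "good_sub x [] us"
inductive_cases good_sub_ConsE: "good_sub x (i # is) us"

lemma good_sub_Cons_iff:
  "good_sub x (i # is) us \<longleftrightarrow>
     (\<exists>us'. us = i # us' \<and> good_sub (\<rho> i x) is us') \<or> \<rho> i x = x \<and> good_sub x is us"
  by (auto elim: good_sub_ConsE intro: good_sub.intros)

lemma good_sub_refl: "good_sub x is is"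
  by (induction "is" arbitrary: x) (auto intro: good_sub.intros)

lemma good_sub_path_end: "good_sub x is us \<Longrightarrow> path_end x us = path_end x is"
  by (induction rule: good_sub.induct) auto

lemma good_sub_set: "good_sub x is us \<Longrightarrow> set us \<subseteq> set is"
  by (induction rule: good_sub.induct) auto

lemma good_sub_append:
  "good_sub x is us \<Longrightarrow> good_sub (path_end x is) js vs \<Longrightarrow> good_sub x (is @ js) (us @ vs)"
  by (induction rule: good_sub.induct) (auto intro: good_sub.intros)

lemma good_sub_appendE:
  assumes "good_sub x (is @ js) ws"
  obtains us vs where "ws = us @ vs" "good_sub x is us" "good_sub (path_end x is) js vs"
  using assms
proof (induction "is" arbitrary: x ws thesis)
  case Nil
  then show ?case by (auto intro: good_sub.Nil)
next
  case (Cons i "is")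
  from Cons.prems(2) consider ws' where "ws = i # ws'" "good_sub (\<rho> i x) (is @ js) ws'"
    | "\<rho> i x = x" "good_sub x (is @ js) ws"
    by (auto simp: good_sub_Cons_iff)
  then show ?case
  proof cases
    case (1 ws')
    then obtain us vs where "ws' = us @ vs" "good_sub (\<rho> i x) is us" "good_sub (path_end (\<rho> i x) is) js vs"
      using Cons.IH by blast
    with 1 show ?thesis by (intro Cons.prems(1)[of "i # us" vs]) (auto intro: good_sub.Keep)
  next
    case 2
    then obtain us vs where "ws = us @ vs" "good_sub x is us" "good_sub (path_end x is) js vs"
      using Cons.IH by blast
    with 2 show ?thesis by (intro Cons.prems(1)[of us vs]) (auto intro: good_sub.Skip)
  qed
qed

lemma path_object_Cons_Suc: "path_object \<rho> x (i # is) (Suc z) = path_object \<rho> (\<rho> i x) is z"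
  by (simp add: path_object_def)

lemma path_object_0: "path_object \<rho> x is 0 = x"
  by (simp add: path_object_def)

lemma good_sub_nths:
  assumes "\<forall>z \<in> {..<length is} - P. path_object \<rho> x is (Suc z) = path_object \<rho> x is z"
  shows "good_sub x is (nths is P)"
  using assms
proof (induction "is" arbitrary: x P)
  case (Cons i "is")
  have "path_object \<rho> (\<rho> i x) is (Suc z) = path_object \<rho> (\<rho> i x) is z"
    if "z \<in> {..<length is} - {j. Suc j \<in> P}" for z
    using bspec[OF Cons.prems, of "Suc z"] that by (auto simp: path_object_Cons_Suc)
  then have *: "good_sub (\<rho> i x) is (nths is {j. Suc j \<in> P})" by (intro Cons.IH) blast
  show ?case
  proof (cases "0 \<in> P")
    case False
    then have "\<rho> i x = x"
      using bspec[OF Cons.prems, of 0] by (simp add: path_object_Cons_Suc path_object_0)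
    with * False show ?thesis by (auto simp: nths_Cons intro: good_sub.Skip)
  qed (use * in \<open>auto simp: nths_Cons intro: good_sub.Keep\<close>)
qed (auto intro: good_sub.Nil)

text \<open>Positions in the tail move up by one under a new first letter, and position 0 is added
  exactly when that letter is kept.\<close>

lemma good_sub_imp_nths:
  assumes "good_sub x is us"
  shows "\<exists>P \<subseteq> {..<length is}. us = nths is P \<and>
    (\<forall>z \<in> {..<length is} - P. path_object \<rho> x is (Suc z) = path_object \<rho> x is z)"
  using assms
proof (induction rule: good_sub.induct)
  case (Keep i x "is" us)
  then obtain P where P: "P \<subseteq> {..<length is}" "us = nths is P"
    "\<forall>z \<in> {..<length is} - P. path_object \<rho> (\<rho> i x) is (Suc z) = path_object \<rho> (\<rho> i x) is z" by blast
  have "path_object \<rho> x (i # is) (Suc z) = path_object \<rho> x (i # is) z"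
    if "z \<in> {..<length (i # is)} - insert 0 (Suc ` P)" for z
    using P(3) that by (cases z) (auto simp: path_object_Cons_Suc)
  moreover have "nths (i # is) (insert 0 (Suc ` P)) = i # us"
    using P(2) by (simp add: nths_Cons inj_image_mem_iff)
  ultimately show ?case using P(1) by (intro exI[of _ "insert 0 (Suc ` P)"]) auto
next
  case (Skip i x "is" us)
  then obtain P where P: "P \<subseteq> {..<length is}" "us = nths is P"
    "\<forall>z \<in> {..<length is} - P. path_object \<rho> x is (Suc z) = path_object \<rho> x is z" by blast
  have "path_object \<rho> x (i # is) (Suc z) = path_object \<rho> x (i # is) z"
    if "z \<in> {..<length (i # is)} - Suc ` P" for z
    using P(3) that Skip.hyps by (cases z) (auto simp: path_object_Cons_Suc path_object_0)
  moreover have "nths (i # is) (Suc ` P) = us"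
    using P(2) by (simp add: nths_Cons inj_image_mem_iff)
  ultimately show ?case using P(1) by (intro exI[of _ "Suc ` P"]) auto
qed auto

text \<open>The path never leaves \<open>z\<close>, so every position may be omitted: the first
  \<open>n\<close> letters are kept, the others skipped.\<close>

lemma good_sub_alternating_fixed:
  "\<rho> p z = z \<Longrightarrow> \<rho> q z = z \<Longrightarrow> n \<le> m \<Longrightarrow> good_sub z (alternating p q m) (alternating p q n)"
proof (induction m arbitrary: p q n)
  case (Suc m)
  show ?case
  proof (cases n)
    case 0
    then show ?thesis using Suc.IH[of q p 0] Suc.prems by (auto intro: good_sub.Skip)
  next
    case (Suc n')
    then show ?thesis using Suc.IH[of q p n'] Suc.prems by (auto intro: good_sub.Keep)
  qed
qed (auto intro: good_sub.Nil)

lemma distinct_adj_alternating: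
  "set us \<subseteq> {p, q} \<Longrightarrow> distinct_adj us \<Longrightarrow>
     us = alternating p q (length us) \<or> us = alternating q p (length us)"
proof (induction us)
  case (Cons i us)
  then show ?case by (cases us) auto
qed simp

text \<open>
  Objects fixed by exactly one of the two letters are the end points of the orbit. An omitted
  interior position would make the two neighbouring letters equal and adjacent, so unless both
  letters fix the orbit, only the first and the last position can be omitted.
\<close>

lemma good_sub_alternating_cases:
  assumes "z \<in> X" "good_sub z (alternating p q m) v" "distinct_adj v"
  shows "v = alternating p q m \<or>
    \<rho> p z = z \<and> \<rho> q z = z \<and> length v < m \<or>
    (\<exists>n. m = Suc n \<and> \<rho> p z = z \<and> v = alternating q p n) \<or>
    (\<exists>n. m = Suc n \<and> v = alternating p q n \<and>
       path_end z (alternating p q m) = path_end z (alternating p q n)) \<or>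
    (\<exists>n. m = Suc (Suc n) \<and> \<rho> p z = z \<and> v = alternating q p n \<and>
       path_end z (alternating p q m) = path_end z (alternating p q (Suc n)))"
    (is "?P p q z m v")
  using assms
proof (induction m arbitrary: p q z v)
  case 0
  then show ?case by (auto elim: good_sub_NilE)
next
  case (Suc m)
  from Suc.prems(2) consider v' where "v = p # v'" "good_sub (\<rho> p z) (alternating q p m) v'"
    | "\<rho> p z = z" "good_sub z (alternating q p m) v"
    by (auto simp: good_sub_Cons_iff)
  then show ?case
  proof cases
    case (1 v')
    have "distinct_adj v'" using Suc.prems(3) 1 by (auto dest: distinct_adj_ConsD)
    then have "?P q p (\<rho> p z) m v'" using 1 Suc rho_in by blast
    moreover have fixed: "\<rho> p z = z \<and> \<rho> q z = z" if "\<rho> q (\<rho> p z) = \<rho> p z" "\<rho> p (\<rho> p z) = \<rho> p z"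
      using that invol[OF Suc.prems(1)] by metis
    ultimately consider "v' = alternating q p m"
      | "\<rho> p z = z \<and> \<rho> q z = z" "length v' < m"
      | n where "m = Suc n" "\<rho> q (\<rho> p z) = \<rho> p z" "v' = alternating p q n"
      | n where "m = Suc n" "v' = alternating q p n"
         "path_end (\<rho> p z) (alternating q p m) = path_end (\<rho> p z) (alternating q p n)"
      | n where "m = Suc (Suc n)" "\<rho> q (\<rho> p z) = \<rho> p z" "v' = alternating p q n"
         "path_end (\<rho> p z) (alternating q p m) = path_end (\<rho> p z) (alternating q p (Suc n))"
      by metis
    then show ?thesis
    proof cases
      case (3 n)
      \<comment> \<open>Here the letter after the kept \<open>p\<close> is omitted; a nonempty
        \<open>v'\<close> would start with \<open>p\<close> again, against
        \<open>distinct_adj v\<close>.\<close>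
      have "n = 0" using Suc.prems(3) 1 3 by (cases n) auto
      then show ?thesis using 1 3 by simp
    next
      case (5 n)
      have "n = 0" using Suc.prems(3) 1 5 by (cases n) auto
      then have "\<rho> p z = z \<and> \<rho> q z = z" using 5 fixed by simp
      then show ?thesis using 1 5 \<open>n = 0\<close> by simp
    qed (use 1 in auto)
  next
    case 2
    \<comment> \<open>The first \<open>p\<close> is omitted, so the rest starts at \<open>z\<close>
      too. If the rest also omits its first letter, both letters fix \<open>z\<close>.\<close>
    then have "?P q p z m v" using Suc by blast
    then show ?thesis using 2 by (elim disjE exE conjE) (auto)
  qed
qed

text \<open>If nothing is omitted, the other side of the braid relation is selected. In all other
  cases the same word \<open>v\<close> is found on the other side, at different positions.\<close>

lemma good_sub_braid:
  assumes z: "z \<in> X" and m: "root_count \<Delta> z p q = enat m"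
    and sub: "good_sub z (alternating p q m) v" and adj: "distinct_adj v"
  shows "\<exists>v'. good_sub z (alternating q p m) v' \<and> equivalent z v v' \<and> length v' = length v"
proof -
  have eq: "equivalent z (alternating p q m) (alternating q p m)"
    using m by (rule equivalent_alternating)
  have ends: "path_end z (alternating q p m) = path_end z (alternating p q m)"
    using equivalent_invariant[OF eq z] by simp
  have fixed: ?thesis if p: "\<rho> p z = z" and q: "\<rho> q z = z" and len: "length v < m"
  proof -
    \<comment> \<open>To start with \<open>p\<close>, the selection must skip the leading
      \<open>q\<close>; strictness of \<open>len\<close> leaves enough letters for
      \<open>v\<close>.\<close>
    obtain m' where m': "m = Suc m'" "length v \<le> m'" using len by (cases m) auto
    have "set v \<subseteq> {p, q}" using good_sub_set[OF sub] set_alternating[of p q m] by blast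
    then have "v = alternating p q (length v) \<or> v = alternating q p (length v)"
      using adj by (rule distinct_adj_alternating)
    moreover have "good_sub z (alternating q p m) (alternating q p (length v))"
      using p q len by (intro good_sub_alternating_fixed) auto
    moreover have "good_sub z (alternating q p m) (alternating p q (length v))"
      using p q m' good_sub_alternating_fixed[of p z q "length v" m'] by (auto intro: good_sub.Skip)
    ultimately have "good_sub z (alternating q p m) v" by metis
    then show ?thesis by (blast intro: word_eq.refl)
  qed
  \<comment> \<open>An omissible last position on the left becomes an omissible first position on
    the right: both paths end at the same object, and the common tail
    \<open>alternating p q n\<close> is injective on objects.\<close>
  have q_fixed: "\<rho> q z = z"
    if "m = Suc n" "path_end z (alternating p q m) = path_end z (alternating p q n)" for n
  proof (rule path_end_inj[OF rho_in[OF z] z])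
    show "path_end (\<rho> q z) (alternating p q n) = path_end z (alternating p q n)"
      using ends that by simp
  qed
  from good_sub_alternating_cases[OF z sub adj] consider
      "v = alternating p q m"
    | "\<rho> p z = z" "\<rho> q z = z" "length v < m"
    | n where "m = Suc n" "\<rho> p z = z" "v = alternating q p n"
    | n where "m = Suc n" "v = alternating p q n" "\<rho> q z = z"
    | n where "m = Suc (Suc n)" "\<rho> p z = z" "v = alternating q p n" "\<rho> q z = z"
    using q_fixed by blast
  then show ?thesis
  proof cases
    case 1
    then show ?thesis using eq good_sub_refl[of z "alternating q p m"] by auto
  next
    case 2
    then show ?thesis by (rule fixed)
  next
    case (3 n)
    let ?c = "if even n then q else p" and ?y = "path_end z (alternating q p n)"
    have snoc: "alternating q p m = alternating q p n @ [?c]"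
      unfolding 3 by (rule alternating_Suc_snoc)
    have "path_end z (alternating q p m) = ?y" using ends 3 by simp
    then have "\<rho> ?c ?y = ?y" by (simp add: snoc)
    then have "good_sub ?y [?c] []" by (intro good_sub.Skip good_sub.Nil)
    then have "good_sub z (alternating q p n @ [?c]) (alternating q p n @ [])"
      by (intro good_sub_append good_sub_refl)
    then have "good_sub z (alternating q p m) v" by (simp only: snoc 3(3) append_Nil2)
    then show ?thesis by (blast intro: word_eq.refl)
  next
    case (4 n)
    then have "good_sub z (alternating q p m) v" by (auto intro: good_sub.Skip good_sub_refl)
    then show ?thesis by (blast intro: word_eq.refl)
  next
    case (5 n)
    then show ?thesis by (intro fixed) auto
  qed
qed

lemma good_sub_braid_step:
  assumes x: "x \<in> X" and step: "braid_step x ws ws'"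
    and sub: "good_sub x ws v" and adj: "distinct_adj v"
  shows "\<exists>v'. good_sub x ws' v' \<and> equivalent x v v' \<and> length v' = length v"
  using step
proof cases
  case (1 p q us m vs)
  let ?z = "path_end x us"
  from sub obtain v1 v2 v3 where v: "v = v1 @ v2 @ v3" and v1: "good_sub x us v1"
    and v2: "good_sub ?z (alternating p q m) v2"
    and v3: "good_sub (path_end ?z (alternating p q m)) vs v3"
    unfolding 1 by (auto elim!: good_sub_appendE)
  have "distinct_adj v2" using adj by (auto simp: v distinct_adj_append_iff)
  then obtain v2' where v2': "good_sub ?z (alternating q p m) v2'" "equivalent ?z v2 v2'"
      "length v2' = length v2"
    using good_sub_braid[OF path_end_in[OF x] _ v2] 1 by blast
  have "path_end ?z (alternating q p m) = path_end ?z (alternating p q m)"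
    using equivalent_invariant(1)[OF equivalent_alternating path_end_in[OF x]] 1 by metis
  then have "good_sub x ws' (v1 @ v2' @ v3)"
    unfolding 1 using v1 v2' v3 by (intro good_sub_append) auto
  moreover have "equivalent x v (v1 @ v2' @ v3)"
    unfolding v using v2' good_sub_path_end[OF v1]
    by (intro equivalent_append_left equivalent_append_right) simp
  ultimately show ?thesis using v2' by (auto simp: v)
qed

lemma good_sub_braids:
  assumes x: "x \<in> X" and geo: "geodesic x v" and sub: "good_sub x ws v" and br: "braids x ws ws'"
  shows "\<exists>v'. good_sub x ws' v' \<and> equivalent x v v' \<and> length v' = length v"
  using br
proof (induction rule: rtranclp_induct)
  case base
  show ?case by (intro exI[of _ v]) (simp add: sub word_eq.refl)
next
  case (step vs ws')
  then obtain v' where v': "good_sub x vs v'" "equivalent x v v'" "length v' = length v" by blast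
  \<comment> \<open>Same action and same length preserve geodesicity, which supplies
    \<open>distinct_adj\<close> for the next move.\<close>
  have "geodesic x v'"
    using geodesic_cong[of x v v'] equivalent_invariant(2)[OF v'(2) x] v'(3) geo by simp
  then obtain v'' where "good_sub x ws' v''" "equivalent x v' v''" "length v'' = length v'"
    using good_sub_braid_step[OF x step.hyps(2) v'(1)] geodesic_distinct_adj[OF x] by blast
  then show ?case using v' word_eq.trans by metis
qed

section \<open>From words back to arrows of the groupoid\<close>

lemma weyl_prod_eq_iff:
  assumes "x \<in> X"
  shows "weyl_prod \<rho> \<Delta> x us = weyl_prod \<rho> \<Delta> x vs \<longleftrightarrow> equivalent x us vs"
proof
  assume "weyl_prod \<rho> \<Delta> x us = weyl_prod \<rho> \<Delta> x vs"
  then show "equivalent x us vs"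
    by (auto simp: weyl_prod_eq_word_arrow word_arrow_def intro: word_eq.refl)
next
  assume eq: "equivalent x us vs"
  then have "path_end x us = path_end x vs" using equivalent_invariant assms by blast
  with eq show "weyl_prod \<rho> \<Delta> x us = weyl_prod \<rho> \<Delta> x vs"
    by (auto simp: weyl_prod_eq_word_arrow word_arrow_def word_source_eq comp_def
        intro: word_eq.sym word_eq.trans)
qed

lemma source_weyl_prod: "source (weyl_prod \<rho> \<Delta> x us) = path_end x us"
  by (simp add: weyl_prod_eq_word_arrow word_arrow_def word_source_eq comp_def)

lemma target_weyl_prod: "target (weyl_prod \<rho> \<Delta> x us) = x"
  by (simp add: weyl_prod_eq_word_arrow word_arrow_def)

lemma geodesic_if_reduced:
  assumes x: "x \<in> X" and len: "weyl_length \<rho> \<Delta> (weyl_prod \<rho> \<Delta> x us) = length us"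
  shows "geodesic x us"
proof (rule ccontr)
  assume "\<not> geodesic x us"
  then obtain vs where vs: "equivalent x us vs" "length vs < length us"
    using shorten_not_geodesic[OF x] by blast
  then have "weyl_prod \<rho> \<Delta> x us = weyl_prod \<rho> \<Delta> x vs" by (simp add: weyl_prod_eq_iff[OF x])
  then have "weyl_length \<rho> \<Delta> (weyl_prod \<rho> \<Delta> x us) \<le> length vs"
    unfolding weyl_length_def target_weyl_prod by (intro Least_le) auto
  with len vs show False by simp
qed

end

theorem theorem5p2:
  fixes X :: "'x set"
    and \<rho> :: "'i::finite \<Rightarrow> 'x \<Rightarrow> 'x"
    and C :: "'x \<Rightarrow> int ^ 'i ^ 'i"
    and \<Delta> :: "'x \<Rightarrow> (int ^ 'i) set"
    and x y :: 'x
    and w u :: "('x, 'i) arrow"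
    and i j :: "'i list"
    and P :: "nat set"
  assumes "finite X"
    and "semi_cartan_graph X \<rho> C"
    and "generalized_root_system X \<rho> C \<Delta>"
    and "x \<in> X" and "y \<in> X"
    and "w \<in> weyl_hom \<rho> \<Delta> y x"
    and "weyl_length \<rho> \<Delta> w > 0"
    and "reduced_expression \<rho> \<Delta> w i"
    and "reduced_expression \<rho> \<Delta> w j"
    and "good_positions \<rho> y x i P"
    and "u = weyl_prod \<rho> \<Delta> x (nths i P)"
    and "u \<in> weyl_hom \<rho> \<Delta> y x"
    and "weyl_length \<rho> \<Delta> u = card P"
  shows "\<exists>Q. card Q = card P \<and> good_positions \<rho> y x j Q \<and> u = weyl_prod \<rho> \<Delta> x (nths j Q)"
proof -
  interpret generalized_root_system X \<rho> C \<Delta> by fact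
  note x = \<open>x \<in> X\<close>
  have target: "target w = x" and source: "source w = y"
    using \<open>w \<in> weyl_hom \<rho> \<Delta> y x\<close> by (auto simp: weyl_hom_def word_arrow_def)
  have i: "w = weyl_prod \<rho> \<Delta> x i" "weyl_length \<rho> \<Delta> w = length i"
    and j: "w = weyl_prod \<rho> \<Delta> x j" "weyl_length \<rho> \<Delta> w = length j"
    using assms(8,9)[unfolded reduced_expression_def target] by metis+
  have "equivalent x i j" using i j by (simp flip: weyl_prod_eq_iff[OF x])
  moreover have "geodesic x i" "geodesic x j" using i j geodesic_if_reduced[OF x] by metis+
  ultimately have br: "braids x i j"
    using geodesics_connected_by_braids[OF x] equivalent_invariant(2)[OF _ x] by blast
  have P: "P \<subseteq> {..<length i}"
    "\<forall>z \<in> {..<length i} - P. path_object \<rho> x i (Suc z) = path_object \<rho> x i z"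
    using assms(10) by (auto simp: good_positions_def)
  \<comment> \<open>Translates the length of a selected word into the number of positions, which
    requires all positions to lie within the word.\<close>
  have card_eq: "length (nths k Q) = card Q" if "Q \<subseteq> {..<length k}" for k :: "'i list" and Q
    using that by (auto simp: length_nths intro!: arg_cong[of _ _ card])
  have "geodesic x (nths i P)"
    using geodesic_if_reduced[OF x, of "nths i P"] assms(11,13) card_eq[OF P(1)] by simp
  then obtain v where v: "good_sub x j v" "equivalent x (nths i P) v" "length v = card P"
    using good_sub_braids[OF x _ good_sub_nths[OF P(2)] br] card_eq[OF P(1)] by auto
  from good_sub_imp_nths[OF v(1)] obtain Q where Q: "Q \<subseteq> {..<length j}" "v = nths j Q"
    "\<forall>z \<in> {..<length j} - Q. path_object \<rho> x j (Suc z) = path_object \<rho> x j z" by blast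
  have "path_object \<rho> x j (length j) = y"
    using source j(1) source_weyl_prod[of x j] by (simp add: path_object_def)
  then have "good_positions \<rho> y x j Q" using Q by (simp add: good_positions_def)
  moreover have "u = weyl_prod \<rho> \<Delta> x (nths j Q)"
    using v(2) Q(2) assms(11) by (simp add: weyl_prod_eq_iff[OF x])
  moreover have "card Q = card P" using card_eq[OF Q(1)] Q(2) v(3) by simp
  ultimately show ?thesis by blast
qed

end
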